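(* (1) The Polish monoid $\mathbb N^{\mathbb N}$ is a universal separable metrizable r-NA monoid; that is, it is itself a separable metrizable r-NA topological monoid, and every separable metrizable r-NA topological monoid embeds, as a topological monoid, into $\mathbb N^{\mathbb N}$. More generally, for every infinite cardinal $\kappa$, $\kappa^\kappa$ is a universal r-NA monoid of weight $\kappa$; that is, $\kappa^{\kappa}$ is an r-NA topological monoid of weight $\kappa$, and every r-NA topological monoid of weight $\kappa$ embeds, as a topological monoid, into $\kappa^\kappa$. (2) The Polish monoid $C(2^\omega,2^\omega)$ is universal for separable metrizable l-NA monoids; that is, it is a separable metrizable l-NA topological monoid, and every separable metrizable l-NA topological monoid embeds, as a topological monoid, into $C(2^\omega,2^\omega)$.
   Context: All topological spaces are Tychonoff. A topological monoid is a monoid with a Tychonoff topology for which multiplication is jointly continuous. Monoid homomorphisms preserve the identity; an embedding of topological monoids is an injective homomorphism which is a homeomorphism onto its image. A Stone space is a compact Hausdorff space with a base of clopen sets. A topological monoid $S$ is l-NA (left non-archimedean) if there are a Stone space $Y$, a jointly continuous left monoid action $S\times Y\to Y$ (with $e_S$ acting as the identity), and a topological embedding $\nu:S\hookrightarrow Y$ with dense image such that $\nu(st)=s\nu(t)$ for all $s,t\in S$. It is r-NA (right non-archimedean) if there are a Stone space $Y$, a jointly continuous right monoid action $Y\times S\to Y$, and a topological embedding $\nu:S\hookrightarrow Y$ with dense image such that $\nu(ts)=\nu(t)s$ for all $s,t\in S$. For an infinite cardinal $\kappa$ regarded as a discrete set, $\kappa^\kappa$ is the monoid of all self-maps of $\kappa$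 under composition with the pointwise (product) topology; $\mathbb N^{\mathbb N}$ is the case of the countable discrete set $\mathbb N$. $2^\omega$ is the Cantor cube and $C(2^\omega,2^\omega)$ is the monoid of its continuous self-maps under composition with the compact-open topology. *)

theory Defs
  imports "HOL-Analysis.Analysis" "HOL-Algebra.Group"
begin

section \<open>Bases, weight, Stone spaces\<close>

definition base_of_topology :: "'a topology \<Rightarrow> 'a set set \<Rightarrow> bool" where
  "base_of_topology X \<B> \<longleftrightarrow>
     (\<forall>V\<in>\<B>. openin X V) \<and>
     (\<forall>U x. openin X U \<and> x \<in> U \<longrightarrow> (\<exists>V\<in>\<B>. x \<in> V \<and> V \<subseteq> U))"

text \<open>Cardinals are the cardinal orders of the library; the set that carries the cardinal
  \<open>\<kappa>\<close> is \<open>Field \<kappa>\<close>. The weight is the least cardinality of a base.\<close>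

definition has_weight :: "'a topology \<Rightarrow> 'k rel \<Rightarrow> bool" where
  "has_weight X \<kappa> \<longleftrightarrow>
     (\<exists>\<B>. base_of_topology X \<B> \<and> (card_of \<B>, \<kappa>) \<in> ordIso) \<and>
     (\<forall>\<B>. base_of_topology X \<B> \<longrightarrow> (\<kappa>, card_of \<B>) \<in> ordLeq)"

definition stone_space :: "'a topology \<Rightarrow> bool" where
  "stone_space Y \<longleftrightarrow> compact_space Y \<and> Hausdorff_space Y \<and>
     (\<exists>\<B>. base_of_topology Y \<B> \<and> (\<forall>V\<in>\<B>. closedin Y V))"

definition polish_topology :: "'a topology \<Rightarrow> bool" where
  "polish_topology X \<longleftrightarrow> separable_space X \<and> completely_metrizable_space X"

section \<open>Topological monoids and their embeddings\<close>

definition topological_monoid :: "'a monoid \<Rightarrow> 'a topology \<Rightarrow> bool" where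
  "topological_monoid S T \<longleftrightarrow>
     monoid S \<and> topspace T = carrier S \<and>
     completely_regular_space T \<and> Hausdorff_space T \<and>
     continuous_map (prod_topology T T) T (\<lambda>(s, t). s \<otimes>\<^bsub>S\<^esub> t)"

definition top_monoid_embedding ::
    "'a monoid \<Rightarrow> 'a topology \<Rightarrow> 'b monoid \<Rightarrow> 'b topology \<Rightarrow> ('a \<Rightarrow> 'b) \<Rightarrow> bool" where
  "top_monoid_embedding S T S' T' f \<longleftrightarrow>
     f \<in> hom S S' \<and> f \<one>\<^bsub>S\<^esub> = \<one>\<^bsub>S'\<^esub> \<and> embedding_map T T' f"

definition embeds_as_top_monoid ::
    "'a monoid \<Rightarrow> 'a topology \<Rightarrow> 'b monoid \<Rightarrow> 'b topology \<Rightarrow> bool" where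
  "embeds_as_top_monoid S T S' T' \<longleftrightarrow> (\<exists>f. top_monoid_embedding S T S' T' f)"

section \<open>Non-archimedean monoids\<close>

definition left_NA_compactification ::
    "'a monoid \<Rightarrow> 'a topology \<Rightarrow> 'y topology \<Rightarrow> ('a \<Rightarrow> 'y \<Rightarrow> 'y) \<Rightarrow> ('a \<Rightarrow> 'y) \<Rightarrow> bool" where
  "left_NA_compactification S T Y act \<nu> \<longleftrightarrow>
     stone_space Y \<and>
     continuous_map (prod_topology T Y) Y (\<lambda>(s, y). act s y) \<and>
     (\<forall>y\<in>topspace Y. act \<one>\<^bsub>S\<^esub> y = y) \<and>
     (\<forall>s\<in>carrier S. \<forall>t\<in>carrier S. \<forall>y\<in>topspace Y. act (s \<otimes>\<^bsub>S\<^esub> t) y = act s (act t y)) \<and>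
     embedding_map T Y \<nu> \<and>
     Abstract_Topology.closure_of Y (\<nu> ` topspace T) = topspace Y \<and>
     (\<forall>s\<in>carrier S. \<forall>t\<in>carrier S. \<nu> (s \<otimes>\<^bsub>S\<^esub> t) = act s (\<nu> t))"

definition right_NA_compactification ::
    "'a monoid \<Rightarrow> 'a topology \<Rightarrow> 'y topology \<Rightarrow> ('y \<Rightarrow> 'a \<Rightarrow> 'y) \<Rightarrow> ('a \<Rightarrow> 'y) \<Rightarrow> bool" where
  "right_NA_compactification S T Y act \<nu> \<longleftrightarrow>
     stone_space Y \<and>
     continuous_map (prod_topology Y T) Y (\<lambda>(y, s). act y s) \<and>
     (\<forall>y\<in>topspace Y. act y \<one>\<^bsub>S\<^esub> = y) \<and>
     (\<forall>s\<in>carrier S. \<forall>t\<in>carrier S. \<forall>y\<in>topspace Y. act y (s \<otimes>\<^bsub>S\<^esub> t) = act (act y s) t) \<and>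
     embedding_map T Y \<nu> \<and>
     Abstract_Topology.closure_of Y (\<nu> ` topspace T) = topspace Y \<and>
     (\<forall>s\<in>carrier S. \<forall>t\<in>carrier S. \<nu> (t \<otimes>\<^bsub>S\<^esub> s) = act (\<nu> t) s)"

text \<open>A Hausdorff space with a dense image of a set of type \<open>'a set\<close> is homeomorphic to a
  space on the type \<open>'a set set\<close>. Hence letting \<open>Y\<close> range over the topologies on this type
  is no restriction: see the lemmas \<open>l_NA_I\<close> and \<open>r_NA_I\<close>, where \<open>Y\<close> has an
  arbitrary type.\<close>

definition l_NA :: "'a monoid \<Rightarrow> 'a topology \<Rightarrow> bool" where
  "l_NA S T \<longleftrightarrow> topological_monoid S T \<and>
     (\<exists>(Y :: 'a set set topology) act \<nu>. left_NA_compactification S T Y act \<nu>)"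

definition r_NA :: "'a monoid \<Rightarrow> 'a topology \<Rightarrow> bool" where
  "r_NA S T \<longleftrightarrow> topological_monoid S T \<and>
     (\<exists>(Y :: 'a set set topology) act \<nu>. right_NA_compactification S T Y act \<nu>)"

lemma Hausdorff_dense_image_homeomorphic:
  fixes Y :: "'y topology" and f :: "'a \<Rightarrow> 'y"
  assumes H: "Hausdorff_space Y" and d: "Abstract_Topology.closure_of Y (f ` A) = topspace Y"
  obtains Y' :: "'a set set topology" and \<phi> \<psi> where "homeomorphic_maps Y Y' \<phi> \<psi>"
proof -
  define \<phi> where "\<phi> y = {{a \<in> A. f a \<in> U} | U. openin Y U \<and> y \<in> U}" for y
  have inj: "inj_on \<phi> (topspace Y)"
  proof (rule inj_onI, rule ccontr)
    fix x y assume xy: "x \<in> topspace Y" "y \<in> topspace Y" "\<phi> x = \<phi> y" "x \<noteq> y"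
    obtain U V where UV: "openin Y U" "openin Y V" "x \<in> U" "y \<in> V" "disjnt U V"
      using H xy(1,2,4) unfolding Hausdorff_space_def by metis
    have "{a \<in> A. f a \<in> U} \<in> \<phi> x"
      unfolding \<phi>_def using UV(1,3) by (intro CollectI exI[of _ U]) simp
    then have "{a \<in> A. f a \<in> U} \<in> \<phi> y"
      by (simp only: xy(3))
    then obtain W where W: "openin Y W" "y \<in> W" "{a \<in> A. f a \<in> U} = {a \<in> A. f a \<in> W}"
      unfolding \<phi>_def by (elim CollectE exE conjE) (rule that)
    have "openin Y (V \<inter> W)" "y \<in> V \<inter> W" using UV W by auto
    moreover have "y \<in> Abstract_Topology.closure_of Y (f ` A)" using d xy by simp
    ultimately obtain a where "a \<in> A" "f a \<in> V \<inter> W"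
      unfolding in_closure_of by (metis imageE)
    moreover from this have "a \<in> {a \<in> A. f a \<in> W}" by simp
    ultimately show False using UV(5) unfolding W(3)[symmetric] disjnt_def by blast
  qed
  define \<psi> where "\<psi> = inv_into (topspace Y) \<phi>"
  define Y' where "Y' = pullback_topology (\<phi> ` topspace Y) \<psi> Y"
  have \<psi>\<phi>: "\<psi> (\<phi> y) = y" if "y \<in> topspace Y" for y
    using inj that by (simp add: \<psi>_def)
  have ts: "topspace Y' = \<phi> ` topspace Y"
    using \<psi>\<phi> by (auto simp: Y'_def topspace_pullback_topology)
  have "continuous_map Y Y' \<phi>"
    unfolding Y'_def
  proof (rule continuous_map_pullback')
    show "continuous_map Y Y (\<psi> \<circ> \<phi>)"
      by (rule continuous_map_eq[OF continuous_map_id]) (simp add: \<psi>\<phi>)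
  qed auto
  moreover have "continuous_map Y' Y \<psi>"
    using continuous_map_pullback[OF continuous_map_id, of \<open>\<phi> ` topspace Y\<close> \<psi> Y]
    by (simp add: Y'_def)
  ultimately have "homeomorphic_maps Y Y' \<phi> \<psi>"
    using \<psi>\<phi> ts by (auto simp: homeomorphic_maps_def)
  then show thesis by (rule that)
qed

lemma homeomorphic_stone_space:
  assumes h: "homeomorphic_maps Y Y' \<phi> \<psi>" and S: "stone_space Y"
  shows "stone_space Y'"
proof -
  have hs: "Y homeomorphic_space Y'" using h by (auto simp: homeomorphic_space_def)
  have hm: "homeomorphic_map Y Y' \<phi>" using h by (simp add: homeomorphic_maps_map)
  obtain \<B> where B: "base_of_topology Y \<B>" "\<And>V. V \<in> \<B> \<Longrightarrow> closedin Y V"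
    using S unfolding stone_space_def by blast
  have sub: "V \<subseteq> topspace Y" if "V \<in> \<B>" for V
    using B that by (meson closedin_subset)
  have "base_of_topology Y' ((`) \<phi> ` \<B>)"
    unfolding base_of_topology_def
  proof (intro conjI ballI allI impI)
    fix V assume "V \<in> (`) \<phi> ` \<B>"
    then show "openin Y' V"
      using B(1) hm sub unfolding base_of_topology_def
      by (metis (no_types, lifting) homeomorphic_map_openness imageE)
  next
    fix U x assume U: "openin Y' U \<and> x \<in> U"
    have c: "continuous_map Y Y' \<phi>" using h by (simp add: homeomorphic_maps_def)
    have x: "x \<in> topspace Y'" using U openin_subset by blast
    have px: "\<psi> x \<in> topspace Y" "\<phi> (\<psi> x) = x"
      using h x unfolding homeomorphic_maps_def continuous_map_def by auto
    have "openin Y {y \<in> topspace Y. \<phi> y \<in> U}"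
      using c U by (simp add: openin_continuous_map_preimage)
    then obtain V where "V \<in> \<B>" "\<psi> x \<in> V" "V \<subseteq> {y \<in> topspace Y. \<phi> y \<in> U}"
      using B(1) px U unfolding base_of_topology_def by (metis (mono_tags, lifting) mem_Collect_eq)
    then show "\<exists>V\<in>(`) \<phi> ` \<B>. x \<in> V \<and> V \<subseteq> U"
      using px by (intro bexI[of _ "\<phi> ` V"]) (auto intro: rev_image_eqI)
  qed
  moreover have "closedin Y' V" if "V \<in> (`) \<phi> ` \<B>" for V
    using that B(2) hm sub by (metis (no_types, lifting) homeomorphic_map_closedness imageE)
  ultimately show ?thesis
    using S homeomorphic_compact_space[OF hs] homeomorphic_Hausdorff_space[OF hs]
    unfolding stone_space_def by metis
qed

lemma embedding_map_subset:
  assumes "embedding_map T Y \<nu>"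
  shows "\<nu> ` topspace T \<subseteq> topspace Y"
proof -
  have "\<nu> ` topspace T = topspace (subtopology Y (\<nu> ` topspace T))"
    using assms unfolding embedding_map_def by (rule homeomorphic_imp_surjective_map)
  then show ?thesis by (metis inf_le1 topspace_subtopology)
qed

lemma homeomorphic_dense_embedding:
  assumes h: "homeomorphic_maps Y Y' \<phi> \<psi>" and e: "embedding_map T Y \<nu>"
    and d: "Abstract_Topology.closure_of Y (\<nu> ` topspace T) = topspace Y"
  shows "embedding_map T Y' (\<phi> \<circ> \<nu>)"
    and "Abstract_Topology.closure_of Y' ((\<phi> \<circ> \<nu>) ` topspace T) = topspace Y'"
proof -
  have hm: "homeomorphic_map Y Y' \<phi>" using h by (simp add: homeomorphic_maps_map)
  have "embedding_map Y Y' \<phi>"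
    using hm by (simp add: embedding_map_def homeomorphic_imp_surjective_map)
  with e show "embedding_map T Y' (\<phi> \<circ> \<nu>)"
    by (rule embedding_map_compose)
  have sub: "\<nu> ` topspace T \<subseteq> topspace Y"
    using e by (rule embedding_map_subset)
  show "Abstract_Topology.closure_of Y' ((\<phi> \<circ> \<nu>) ` topspace T) = topspace Y'"
    using homeomorphic_map_closure_of[OF hm sub] d homeomorphic_imp_surjective_map[OF hm]
    by (simp add: image_comp)
qed

lemma l_NA_I:
  fixes Y :: "'y topology"
  assumes M: "topological_monoid S T" and C: "left_NA_compactification S T Y act \<nu>"
  shows "l_NA S T"
proof -
  have Y: "stone_space Y" "embedding_map T Y \<nu>"
      "Abstract_Topology.closure_of Y (\<nu> ` topspace T) = topspace Y"
    and ca: "continuous_map (prod_topology T Y) Y (\<lambda>(s, y). act s y)"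
    and ao: "\<And>y. y \<in> topspace Y \<Longrightarrow> act \<one>\<^bsub>S\<^esub> y = y"
    and am: "\<And>s t y. \<lbrakk>s \<in> carrier S; t \<in> carrier S; y \<in> topspace Y\<rbrakk>
        \<Longrightarrow> act (s \<otimes>\<^bsub>S\<^esub> t) y = act s (act t y)"
    and eq: "\<And>s t. \<lbrakk>s \<in> carrier S; t \<in> carrier S\<rbrakk> \<Longrightarrow> \<nu> (s \<otimes>\<^bsub>S\<^esub> t) = act s (\<nu> t)"
    using C unfolding left_NA_compactification_def by auto
  have TS: "topspace T = carrier S" using M by (simp add: topological_monoid_def)
  obtain Y' :: "'a set set topology" and \<phi> \<psi> where h: "homeomorphic_maps Y Y' \<phi> \<psi>"
    using Hausdorff_dense_image_homeomorphic Y unfolding stone_space_def by metis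
  have c1: "continuous_map Y Y' \<phi>" and c2: "continuous_map Y' Y \<psi>"
    and i1: "\<And>y. y \<in> topspace Y \<Longrightarrow> \<psi> (\<phi> y) = y" and i2: "\<And>y. y \<in> topspace Y' \<Longrightarrow> \<phi> (\<psi> y) = y"
    using h by (auto simp: homeomorphic_maps_def)
  have \<psi>in: "\<psi> y \<in> topspace Y" if "y \<in> topspace Y'" for y
    using c2 that by (auto simp: continuous_map_def)
  have actin: "act s y \<in> topspace Y" if "s \<in> carrier S" "y \<in> topspace Y" for s y
    using ca that TS by (auto simp: continuous_map_def Pi_iff)
  have \<nu>in: "\<nu> s \<in> topspace Y" if "s \<in> carrier S" for s
    using embedding_map_subset[OF Y(2)] that TS by blast
  define act' where "act' s y = \<phi> (act s (\<psi> y))" for s y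
  have "continuous_map (prod_topology T Y') (prod_topology T Y) (\<lambda>(s, y). (s, \<psi> y))"
    using c2 continuous_map_prod_top[of T Y' T Y id \<psi>] by simp
  from continuous_map_compose[OF continuous_map_compose[OF this ca] c1]
  have "continuous_map (prod_topology T Y') Y' (\<lambda>(s, y). act' s y)"
    by (simp add: act'_def o_def case_prod_unfold)
  then have "left_NA_compactification S T Y' act' (\<phi> \<circ> \<nu>)"
    unfolding left_NA_compactification_def act'_def
    using homeomorphic_stone_space[OF h Y(1)] homeomorphic_dense_embedding[OF h Y(2,3)]
    by (simp add: ao am eq i1 i2 \<psi>in actin \<nu>in)
  then show ?thesis using M unfolding l_NA_def by blast
qed

lemma r_NA_I:
  fixes Y :: "'y topology"
  assumes M: "topological_monoid S T" and C: "right_NA_compactification S T Y act \<nu>"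
  shows "r_NA S T"
proof -
  have Y: "stone_space Y" "embedding_map T Y \<nu>"
      "Abstract_Topology.closure_of Y (\<nu> ` topspace T) = topspace Y"
    and ca: "continuous_map (prod_topology Y T) Y (\<lambda>(y, s). act y s)"
    and ao: "\<And>y. y \<in> topspace Y \<Longrightarrow> act y \<one>\<^bsub>S\<^esub> = y"
    and am: "\<And>s t y. \<lbrakk>s \<in> carrier S; t \<in> carrier S; y \<in> topspace Y\<rbrakk>
        \<Longrightarrow> act y (s \<otimes>\<^bsub>S\<^esub> t) = act (act y s) t"
    and eq: "\<And>s t. \<lbrakk>s \<in> carrier S; t \<in> carrier S\<rbrakk> \<Longrightarrow> \<nu> (t \<otimes>\<^bsub>S\<^esub> s) = act (\<nu> t) s"
    using C unfolding right_NA_compactification_def by auto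
  have TS: "topspace T = carrier S" using M by (simp add: topological_monoid_def)
  obtain Y' :: "'a set set topology" and \<phi> \<psi> where h: "homeomorphic_maps Y Y' \<phi> \<psi>"
    using Hausdorff_dense_image_homeomorphic Y unfolding stone_space_def by metis
  have c1: "continuous_map Y Y' \<phi>" and c2: "continuous_map Y' Y \<psi>"
    and i1: "\<And>y. y \<in> topspace Y \<Longrightarrow> \<psi> (\<phi> y) = y" and i2: "\<And>y. y \<in> topspace Y' \<Longrightarrow> \<phi> (\<psi> y) = y"
    using h by (auto simp: homeomorphic_maps_def)
  have \<psi>in: "\<psi> y \<in> topspace Y" if "y \<in> topspace Y'" for y
    using c2 that by (auto simp: continuous_map_def)
  have actin: "act y s \<in> topspace Y" if "s \<in> carrier S" "y \<in> topspace Y" for s y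
    using ca that TS by (auto simp: continuous_map_def Pi_iff)
  have \<nu>in: "\<nu> s \<in> topspace Y" if "s \<in> carrier S" for s
    using embedding_map_subset[OF Y(2)] that TS by blast
  define act' where "act' y s = \<phi> (act (\<psi> y) s)" for s y
  have "continuous_map (prod_topology Y' T) (prod_topology Y T) (\<lambda>(y, s). (\<psi> y, s))"
    using c2 continuous_map_prod_top[of Y' T Y T \<psi> id] by simp
  from continuous_map_compose[OF continuous_map_compose[OF this ca] c1]
  have "continuous_map (prod_topology Y' T) Y' (\<lambda>(y, s). act' y s)"
    by (simp add: act'_def o_def case_prod_unfold)
  then have "right_NA_compactification S T Y' act' (\<phi> \<circ> \<nu>)"
    unfolding right_NA_compactification_def act'_def
    using homeomorphic_stone_space[OF h Y(1)] homeomorphic_dense_embedding[OF h Y(2,3)]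
    by (simp add: ao am eq i1 i2 \<psi>in actin \<nu>in)
  then show ?thesis using M unfolding r_NA_def by blast
qed

section \<open>The universal monoids\<close>

text \<open>As in \<^term>\<open>compose\<close>, self-maps of a set are represented by functions that are
  \<^term>\<open>undefined\<close> outside this set.\<close>

definition self_map_monoid :: "'k set \<Rightarrow> ('k \<Rightarrow> 'k) monoid" where
  "self_map_monoid K =
     \<lparr>carrier = K \<rightarrow>\<^sub>E K, monoid.mult = (\<lambda>f g. compose K f g), one = (\<lambda>x\<in>K. x)\<rparr>"

definition pointwise_topology :: "'k set \<Rightarrow> ('k \<Rightarrow> 'k) topology" where
  "pointwise_topology K = product_topology (\<lambda>_. discrete_topology K) K"

definition continuous_self_maps :: "'x topology \<Rightarrow> ('x \<Rightarrow> 'x) set" where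
  "continuous_self_maps X = {f \<in> extensional (topspace X). continuous_map X X f}"

definition continuous_self_map_monoid :: "'x topology \<Rightarrow> ('x \<Rightarrow> 'x) monoid" where
  "continuous_self_map_monoid X =
     \<lparr>carrier = continuous_self_maps X,
      monoid.mult = (\<lambda>f g. compose (topspace X) f g), one = (\<lambda>x\<in>topspace X. x)\<rparr>"

definition compact_open_topology :: "'x topology \<Rightarrow> ('x \<Rightarrow> 'x) topology" where
  "compact_open_topology X = topology_generated_by
     {{f \<in> continuous_self_maps X. f ` K \<subseteq> U} | K U. compactin X K \<and> openin X U}"

definition cantor_cube :: "(nat \<Rightarrow> bool) topology" where
  "cantor_cube = product_topology (\<lambda>_. discrete_topology UNIV) UNIV"

lemma topspace_pointwise_topology: "topspace (pointwise_topology K) = carrier (self_map_monoid K)"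
  by (simp add: pointwise_topology_def self_map_monoid_def)

lemma topspace_compact_open_topology:
  "topspace (compact_open_topology X) = carrier (continuous_self_map_monoid X)"
proof -
  have "continuous_self_maps X \<in>
    {{f \<in> continuous_self_maps X. f ` K \<subseteq> U} | K U. compactin X K \<and> openin X U}"
    by (rule CollectI, rule exI[of _ "{}"], rule exI[of _ "{}"]) auto
  then show ?thesis
    by (auto simp: compact_open_topology_def topology_generated_by_topspace
        continuous_self_map_monoid_def)
qed

end

theory Submission
  imports Defs
begin

text \<open>A right action of \<open>S\<close> on a Stone space dualizes to a left action on its clopen sets.
  By compactness each clopen set has a locally constant orbit map, so enough clopen sets to separate
  points from closed sets of \<open>S\<close> generate an invariant family no larger than the weight of \<open>S\<close>,
  and \<open>S\<close> embeds into the self-maps of this family. Passing to opposite monoids exchanges l-NA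
  and r-NA. For a Stone space \<open>X\<close>, taking preimages embeds the opposite of \<open>C(X, X)\<close> into the
  self-maps of the clopen algebra of \<open>X\<close>; conversely, \<open>z \<mapsto> z \<circ> h\<close> embeds the opposite of
  \<open>\<nat>\<^sup>\<nat>\<close> into \<open>C(2\<^sup>\<omega>, 2\<^sup>\<omega>)\<close>.\<close>

section \<open>Powers of discrete spaces\<close>

text \<open>The obstacle is size: the Stone space of an r-NA monoid is unrestricted, so its clopen
  algebra may be far larger than the weight of \<open>S\<close>. A selection of clopen sets is
  therefore made through pairs of members of a base of \<open>S\<close>. Adding orbits is harmless,
  because a locally constant function on \<open>S\<close> takes at most as many values as a base has
  members. The selection still recovers the topology of \<open>S\<close>: since \<nu>(1) s =
  \<nu>(s), the set {y. y s \<in> b} contains \<nu>(1) exactly when \<nu>(s) lies in b, so the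
  single coordinate b of the image of s tells whether \<nu>(s) \<in> b.

  That self-map monoids are themselves r-NA needs a compactification. For infinite \<open>K\<close>
  the monoid itself is not compact; graphs, seen as subsets of \<open>K \<times> K\<close>, live in
  a compact cube on which substitution still makes sense. The construction is made for every monoid
  that embeds into a self-map monoid. The l-NA property of C(X, X), and even the continuity of its
  composition, are then inherited through the clopen algebra instead of being checked on the
  compact-open topology.\<close>

abbreviation discrete_power :: "'a set \<Rightarrow> 'i set \<Rightarrow> ('i \<Rightarrow> 'a) topology" where
  "discrete_power A I \<equiv> product_topology (\<lambda>_. discrete_topology A) I"

text \<open>In a discrete factor every restricted side of a basic box around \<open>x\<close> can be
  shrunk to the singleton of \<open>x i\<close>. A neighbourhood thus only records finitely many
  coordinates, which is the form in which openness is used below.\<close>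

lemma openin_discrete_power:
  "openin (discrete_power A I) U \<longleftrightarrow> U \<subseteq> I \<rightarrow>\<^sub>E A \<and>
     (\<forall>x\<in>U. \<exists>F. finite F \<and> F \<subseteq> I \<and> (\<forall>y\<in>I \<rightarrow>\<^sub>E A. (\<forall>i\<in>F. y i = x i) \<longrightarrow> y \<in> U))"
  (is "?l \<longleftrightarrow> ?r")
proof
  assume l: ?l
  have "U \<subseteq> I \<rightarrow>\<^sub>E A" using openin_subset[OF l] by simp
  moreover have "\<exists>F. finite F \<and> F \<subseteq> I \<and> (\<forall>y\<in>I \<rightarrow>\<^sub>E A. (\<forall>i\<in>F. y i = x i) \<longrightarrow> y \<in> U)"
    if "x \<in> U" for x
  proof -
    obtain V where V: "finite {i \<in> I. V i \<noteq> A}" "x \<in> Pi\<^sub>E I V" "Pi\<^sub>E I V \<subseteq> U"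
      using l \<open>x \<in> U\<close> unfolding openin_product_topology_alt by auto
    have "y \<in> Pi\<^sub>E I V" if "y \<in> I \<rightarrow>\<^sub>E A" "\<forall>i\<in>{i \<in> I. V i \<noteq> A}. y i = x i" for y
      using that V(2) by (auto simp: PiE_iff)
    with V show ?thesis by (intro exI[of _ "{i \<in> I. V i \<noteq> A}"]) auto
  qed
  ultimately show ?r by (intro conjI ballI)
next
  assume r: ?r
  show ?l unfolding openin_product_topology_alt
  proof
    fix x assume x: "x \<in> U"
    then obtain F where F: "finite F" "F \<subseteq> I" "\<And>y. y \<in> I \<rightarrow>\<^sub>E A \<Longrightarrow> \<forall>i\<in>F. y i = x i \<Longrightarrow> y \<in> U"
      using bspec[OF conjunct2[OF r] x] by metis
    have xA: "x \<in> I \<rightarrow>\<^sub>E A" using x r by blast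
    let ?V = "\<lambda>i. if i \<in> F then {x i} else A"
    have "finite {i \<in> I. ?V i \<noteq> topspace (discrete_topology A)}"
      by (rule finite_subset[OF _ F(1)]) auto
    moreover have "Pi\<^sub>E I ?V \<subseteq> U"
    proof
      fix y assume y: "y \<in> Pi\<^sub>E I ?V"
      have "y i \<in> A" if "i \<in> I" for i
        using PiE_mem[OF y that] PiE_mem[OF xA that] by (auto split: if_splits)
      then have "y \<in> I \<rightarrow>\<^sub>E A"
        using y by (auto simp: PiE_iff)
      moreover have "y i = x i" if "i \<in> F" for i
        using PiE_mem[OF y, of i] that F(2) by auto
      ultimately show "y \<in> U" using F(3) by blast
    qed
    moreover have "\<forall>i\<in>I. openin (discrete_topology A) (?V i)" "x \<in> Pi\<^sub>E I ?V"
      using xA by (auto simp: PiE_iff)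
    ultimately show "\<exists>V. finite {i \<in> I. V i \<noteq> topspace (discrete_topology A)} \<and>
        (\<forall>i\<in>I. openin (discrete_topology A) (V i)) \<and> x \<in> Pi\<^sub>E I V \<and> Pi\<^sub>E I V \<subseteq> U"
      by (intro exI[of _ ?V] conjI)
  qed
qed

lemma openin_cylinder:
  assumes "finite F" "F \<subseteq> I"
  shows "openin (discrete_power A I) {y \<in> I \<rightarrow>\<^sub>E A. \<forall>i\<in>F. y i = x i}"
  unfolding openin_discrete_power using assms by auto

lemma clopen_coordinate:
  assumes "i \<in> I"
  shows "openin (discrete_power A I) {y \<in> I \<rightarrow>\<^sub>E A. P (y i)}"
    and "closedin (discrete_power A I) {y \<in> I \<rightarrow>\<^sub>E A. P (y i)}"
proof -
  have "continuous_map (discrete_power A I) (discrete_topology A) (\<lambda>y. y i)"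
    using continuous_map_product_projection[OF assms, of "\<lambda>_. discrete_topology A"] by simp
  from openin_continuous_map_preimage[OF this, of "{a \<in> A. P a}"]
    closedin_continuous_map_preimage[OF this, of "{a \<in> A. P a}"]
  have "openin (discrete_power A I) {y \<in> I \<rightarrow>\<^sub>E A. y i \<in> {a \<in> A. P a}}"
    "closedin (discrete_power A I) {y \<in> I \<rightarrow>\<^sub>E A. y i \<in> {a \<in> A. P a}}" by auto
  moreover have "{y \<in> I \<rightarrow>\<^sub>E A. y i \<in> {a \<in> A. P a}} = {y \<in> I \<rightarrow>\<^sub>E A. P (y i)}"
    using assms by auto
  ultimately show "openin (discrete_power A I) {y \<in> I \<rightarrow>\<^sub>E A. P (y i)}"
    "closedin (discrete_power A I) {y \<in> I \<rightarrow>\<^sub>E A. P (y i)}" by simp_all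
qed

lemma closedin_cylinder:
  assumes "finite F" "F \<subseteq> I"
  shows "closedin (discrete_power A I) {y \<in> I \<rightarrow>\<^sub>E A. \<forall>i\<in>F. y i = x i}"
proof (cases "F = {}")
  \<comment> \<open>An empty intersection would be \<open>UNIV\<close> rather than the whole
    product, so this case is separate.\<close>
  case True
  then show ?thesis using closedin_topspace[of "discrete_power A I"] by simp
next
  case False
  then have "{y \<in> I \<rightarrow>\<^sub>E A. \<forall>i\<in>F. y i = x i} = (\<Inter>i\<in>F. {y \<in> I \<rightarrow>\<^sub>E A. y i = x i})" by auto
  moreover have "closedin (discrete_power A I) {y \<in> I \<rightarrow>\<^sub>E A. y i = x i}" if "i \<in> F" for i
    using clopen_coordinate(2)[of i I A "\<lambda>a. a = x i"] that assms by blast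
  ultimately show ?thesis using False by auto
qed

text \<open>Continuity is tested coordinate by coordinate, and a map into a discrete space is
  continuous as soon as it is locally constant. The continuity proofs for composition, the actions
  and the representations all reduce to this test.\<close>

lemma continuous_map_into_discrete_power:
  assumes in_power: "\<And>x. x \<in> topspace X \<Longrightarrow> f x \<in> I \<rightarrow>\<^sub>E A"
    and locally_constant: "\<And>i x. i \<in> I \<Longrightarrow> x \<in> topspace X \<Longrightarrow>
      \<exists>U. openin X U \<and> x \<in> U \<and> (\<forall>y\<in>U. f y i = f x i)"
  shows "continuous_map X (discrete_power A I) f"
  unfolding continuous_map_componentwise
proof (intro conjI ballI)
  fix i assume i: "i \<in> I"
  show "continuous_map X (discrete_topology A) (\<lambda>x. f x i)"
    unfolding continuous_map_def
  proof (intro conjI allI impI)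
    show "(\<lambda>x. f x i) \<in> topspace X \<rightarrow> topspace (discrete_topology A)"
      using PiE_mem[OF in_power i] by simp
    fix U assume "openin (discrete_topology A) U"
    show "openin X {x \<in> topspace X. f x i \<in> U}"
    proof (subst openin_subopen, intro ballI)
      fix x assume x: "x \<in> {x \<in> topspace X. f x i \<in> U}"
      then obtain V where V: "openin X V" "x \<in> V" "\<forall>y\<in>V. f y i = f x i"
        using locally_constant i by blast
      have "y \<in> {x \<in> topspace X. f x i \<in> U}" if "y \<in> V" for y
      proof -
        have "f y i = f x i" using V(3) that by (rule bspec)
        then show ?thesis using x that openin_subset[OF V(1)] by auto
      qed
      then show "\<exists>T. openin X T \<and> x \<in> T \<and> T \<subseteq> {x \<in> topspace X. f x i \<in> U}"
        using V(1,2) by blast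
    qed
  qed
qed (use in_power in \<open>auto simp: PiE_iff\<close>)

lemma Hausdorff_space_discrete_power: "Hausdorff_space (discrete_power A I)"
  by (simp add: Hausdorff_space_product_topology)

lemma completely_regular_space_discrete_power: "completely_regular_space (discrete_power A I)"
  by (simp add: completely_regular_space_product_topology completely_regular_space_discrete_topology)

text \<open>Finiteness of \<open>A\<close> gives compactness by Tychonoff's theorem, and the traces
  of finite cylinders on \<open>C\<close> form the clopen base.\<close>

lemma stone_space_closed_subspace_discrete_power:
  assumes A: "finite A" and C: "closedin (discrete_power A I) C"
  shows "stone_space (subtopology (discrete_power A I) C)"
proof -
  let ?X = "discrete_power A I"
  have "compact_space ?X"
    using A by (simp add: compact_space_product_topology compact_space_discrete_topology)
  then have "compact_space (subtopology ?X C)"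
    using C closedin_compact_space compact_space_subtopology by blast
  moreover have "Hausdorff_space (subtopology ?X C)"
    by (simp add: Hausdorff_space_discrete_power Hausdorff_space_subtopology)
  moreover define \<B> where
    "\<B> = {C \<inter> {y \<in> I \<rightarrow>\<^sub>E A. \<forall>i\<in>F. y i = x i} | F x. finite F \<and> F \<subseteq> I}"
  have "base_of_topology (subtopology ?X C) \<B>"
    unfolding base_of_topology_def
  proof (intro conjI ballI allI impI)
    fix V assume "V \<in> \<B>"
    then show "openin (subtopology ?X C) V"
      unfolding \<B>_def by (auto intro!: openin_subtopology_Int2 openin_cylinder)
  next
    fix U x assume U: "openin (subtopology ?X C) U \<and> x \<in> U"
    then obtain W where W: "openin ?X W" "U = W \<inter> C" unfolding openin_subtopology by blast
    then obtain F where F: "finite F" "F \<subseteq> I" "\<And>y. y \<in> I \<rightarrow>\<^sub>E A \<Longrightarrow> \<forall>i\<in>F. y i = x i \<Longrightarrow> y \<in> W"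
      using U unfolding openin_discrete_power by (metis IntD1)
    have "x \<in> I \<rightarrow>\<^sub>E A" using W U unfolding openin_discrete_power by auto
    then show "\<exists>V\<in>\<B>. x \<in> V \<and> V \<subseteq> U"
      using F U W by (intro bexI[of _ "C \<inter> {y \<in> I \<rightarrow>\<^sub>E A. \<forall>i\<in>F. y i = x i}"]) (auto simp: \<B>_def)
  qed
  moreover have "closedin (subtopology ?X C) V" if "V \<in> \<B>" for V
    using that unfolding \<B>_def by (auto intro!: closedin_subtopology_Int_closed closedin_cylinder)
  ultimately show ?thesis unfolding stone_space_def by blast
qed

text \<open>The condition says that \<open>T\<close> carries the initial topology of
  \<open>f\<close>. Injectivity comes for free: an open set that contains \<open>x\<close> but not
  \<open>y\<close> would have to contain \<open>y\<close> if \<open>f x = f y\<close>.\<close>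

lemma embedding_mapI:
  assumes f: "continuous_map T Y f" and T: "Hausdorff_space T"
    and initial: "\<And>U x. openin T U \<Longrightarrow> x \<in> U \<Longrightarrow>
      \<exists>V. openin Y V \<and> f x \<in> V \<and> (\<forall>x'\<in>topspace T. f x' \<in> V \<longrightarrow> x' \<in> U)"
  shows "embedding_map T Y f"
proof -
  have inj: "inj_on f (topspace T)"
  proof (rule inj_onI, rule ccontr)
    fix x y assume xy: "x \<in> topspace T" "y \<in> topspace T" "f x = f y" "x \<noteq> y"
    then obtain U where "openin T U" "x \<in> U" "y \<notin> U"
      using T unfolding Hausdorff_space_def disjnt_def by blast
    then show False using initial xy by metis
  qed
  have "open_map T (subtopology Y (f ` topspace T)) f"
    unfolding open_map_def
  proof (intro allI impI)
    fix U assume U: "openin T U"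
    show "openin (subtopology Y (f ` topspace T)) (f ` U)"
    proof (subst openin_subopen, intro ballI)
      fix z assume "z \<in> f ` U"
      then obtain x where x: "x \<in> U" "z = f x" by blast
      then obtain V where V: "openin Y V" "f x \<in> V" "\<forall>x'\<in>topspace T. f x' \<in> V \<longrightarrow> x' \<in> U"
        using initial U by blast
      have "openin (subtopology Y (f ` topspace T)) (V \<inter> f ` topspace T)"
        using V(1) by (auto simp: openin_subtopology)
      then show "\<exists>W. openin (subtopology Y (f ` topspace T)) W \<and> z \<in> W \<and> W \<subseteq> f ` U"
        using V x openin_subset[OF U] by (intro exI[of _ "V \<inter> f ` topspace T"]) auto
    qed
  qed
  moreover have "continuous_map T (subtopology Y (f ` topspace T)) f"
    using f by (simp add: continuous_map_in_subtopology)
  moreover have "f ` topspace T = topspace (subtopology Y (f ` topspace T))"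
    using f by (auto simp: continuous_map_def)
  ultimately show ?thesis
    unfolding embedding_map_def using inj by (intro bijective_open_imp_homeomorphic_map)
qed

lemma embedding_mapD:
  assumes "embedding_map T Y f"
  shows "continuous_map T Y f" and "inj_on f (topspace T)"
    and "openin T U \<Longrightarrow> \<exists>V. openin Y V \<and> (\<forall>x\<in>topspace T. f x \<in> V \<longleftrightarrow> x \<in> U)"
proof -
  have h: "homeomorphic_map T (subtopology Y (f ` topspace T)) f"
    using assms by (simp add: embedding_map_def)
  show c: "continuous_map T Y f"
    using h by (simp add: homeomorphic_eq_everything_map continuous_map_in_subtopology)
  show i: "inj_on f (topspace T)"
    using h by (simp add: homeomorphic_eq_everything_map)
  assume U: "openin T U"
  then have "openin (subtopology Y (f ` topspace T)) (f ` U)"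
    using homeomorphic_imp_open_map[OF h] by (simp add: open_map_def)
  then obtain V where V: "openin Y V" "f ` U = V \<inter> f ` topspace T"
    unfolding openin_subtopology by blast
  have "f x \<in> V \<longleftrightarrow> x \<in> U" if "x \<in> topspace T" for x
  proof -
    have "f x \<in> V \<longleftrightarrow> f x \<in> f ` U" using V that by blast
    then show ?thesis using inj_on_image_mem_iff[OF i that openin_subset[OF U]] by blast
  qed
  then show "\<exists>V. openin Y V \<and> (\<forall>x\<in>topspace T. f x \<in> V \<longleftrightarrow> x \<in> U)" using V by blast
qed

section \<open>Opposite monoids and embeddings\<close>

text \<open>Open sets of \<open>T\<close> are the preimages under \<open>f\<close> of open sets of
  \<open>Y\<close>, so continuity into \<open>T\<close> may be tested after composing with
  \<open>f\<close>.\<close>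

lemma continuous_map_into_embedding:
  assumes e: "embedding_map T Y f" and g: "\<And>x. x \<in> topspace X \<Longrightarrow> g x \<in> topspace T"
    and fg: "continuous_map X Y (\<lambda>x. f (g x))"
  shows "continuous_map X T g"
  unfolding continuous_map_def
proof (intro conjI allI impI)
  fix U assume "openin T U"
  then obtain V where V: "openin Y V" "\<forall>x\<in>topspace T. f x \<in> V \<longleftrightarrow> x \<in> U"
    using embedding_mapD(3)[OF e] by blast
  have "{x \<in> topspace X. g x \<in> U} = {x \<in> topspace X. f (g x) \<in> V}"
    using V(2) g by blast
  then show "openin X {x \<in> topspace X. g x \<in> U}"
    using openin_continuous_map_preimage[OF fg V(1)] by simp
qed (use g in blast)

lemma continuous_map_prod_swap:
  "continuous_map (prod_topology X Y) (prod_topology Y X) (\<lambda>(x, y). (y, x))"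
  by (simp add: case_prod_unfold continuous_map_paired continuous_map_fst continuous_map_snd)

definition opposite_monoid :: "'a monoid \<Rightarrow> 'a monoid" where
  "opposite_monoid S = \<lparr>carrier = carrier S, monoid.mult = (\<lambda>a b. b \<otimes>\<^bsub>S\<^esub> a), one = \<one>\<^bsub>S\<^esub>\<rparr>"

lemma opposite_monoid_simps [simp]:
  "carrier (opposite_monoid S) = carrier S"
  "a \<otimes>\<^bsub>opposite_monoid S\<^esub> b = b \<otimes>\<^bsub>S\<^esub> a"
  "\<one>\<^bsub>opposite_monoid S\<^esub> = \<one>\<^bsub>S\<^esub>"
  by (simp_all add: opposite_monoid_def)

lemma opposite_opposite_monoid [simp]: "opposite_monoid (opposite_monoid S) = S"
  by (simp add: opposite_monoid_def)

lemma topological_monoid_opposite: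
  assumes "topological_monoid S T"
  shows "topological_monoid (opposite_monoid S) T"
proof -
  have S: "monoid S" and c: "continuous_map (prod_topology T T) T (\<lambda>(s, t). s \<otimes>\<^bsub>S\<^esub> t)"
    using assms by (auto simp: topological_monoid_def)
  interpret monoid S by (rule S)
  have "monoid (opposite_monoid S)"
    by unfold_locales (auto simp: m_assoc)
  moreover have "continuous_map (prod_topology T T) T ((\<lambda>(s, t). s \<otimes>\<^bsub>S\<^esub> t) \<circ> (\<lambda>(s, t). (t, s)))"
    using continuous_map_compose[OF continuous_map_prod_swap c] .
  then have "continuous_map (prod_topology T T) T (\<lambda>(s, t). t \<otimes>\<^bsub>S\<^esub> s)"
    by (simp add: o_def case_prod_unfold)
  ultimately show ?thesis
    using assms by (auto simp: topological_monoid_def)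
qed

lemma right_NA_compactification_opposite:
  assumes "left_NA_compactification S T Y act \<nu>"
  shows "right_NA_compactification (opposite_monoid S) T Y (\<lambda>y s. act s y) \<nu>"
proof -
  have c: "continuous_map (prod_topology T Y) Y (\<lambda>(s, y). act s y)"
    using assms by (simp add: left_NA_compactification_def)
  have "continuous_map (prod_topology Y T) Y ((\<lambda>(s, y). act s y) \<circ> (\<lambda>(y, s). (s, y)))"
    using continuous_map_compose[OF continuous_map_prod_swap c] .
  then have "continuous_map (prod_topology Y T) Y (\<lambda>(y, s). act s y)"
    by (simp add: o_def case_prod_unfold)
  then show ?thesis
    using assms unfolding left_NA_compactification_def right_NA_compactification_def by simp
qed

lemma left_NA_compactification_opposite:
  assumes "right_NA_compactification S T Y act \<nu>"
  shows "left_NA_compactification (opposite_monoid S) T Y (\<lambda>s y. act y s) \<nu>"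
proof -
  have c: "continuous_map (prod_topology Y T) Y (\<lambda>(y, s). act y s)"
    using assms by (simp add: right_NA_compactification_def)
  have "continuous_map (prod_topology T Y) Y ((\<lambda>(y, s). act y s) \<circ> (\<lambda>(s, y). (y, s)))"
    using continuous_map_compose[OF continuous_map_prod_swap c] .
  then have "continuous_map (prod_topology T Y) Y (\<lambda>(s, y). act y s)"
    by (simp add: o_def case_prod_unfold)
  then show ?thesis
    using assms unfolding left_NA_compactification_def right_NA_compactification_def by simp
qed

lemma r_NA_opposite: "l_NA S T \<Longrightarrow> r_NA (opposite_monoid S) T"
  unfolding l_NA_def r_NA_def
  using topological_monoid_opposite right_NA_compactification_opposite by blast

lemma l_NA_opposite: "r_NA S T \<Longrightarrow> l_NA (opposite_monoid S) T"
  unfolding l_NA_def r_NA_def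
  using topological_monoid_opposite left_NA_compactification_opposite by blast

lemma top_monoid_embedding_opposite:
  assumes "top_monoid_embedding S T S' T' f"
  shows "top_monoid_embedding (opposite_monoid S) T (opposite_monoid S') T' f"
  using assms by (simp add: top_monoid_embedding_def hom_def Pi_iff)

lemma top_monoid_embedding_compose:
  assumes f: "top_monoid_embedding S T S' T' f" and g: "top_monoid_embedding S' T' S'' T'' g"
  shows "top_monoid_embedding S T S'' T'' (g \<circ> f)"
  using assms embedding_map_compose[of T T' f T'' g]
  by (simp add: top_monoid_embedding_def hom_def Pi_iff)

text \<open>Joint continuity and the separation axioms pass to topological submonoids. This serves
  for the opposite of C(X, X), where continuity of composition is pulled back from a self-map
  monoid.\<close>

lemma topological_monoid_if_embeds:
  assumes S: "monoid S" "topspace T = carrier S" and S': "topological_monoid S' T'"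
    and f: "top_monoid_embedding S T S' T' f"
  shows "topological_monoid S T"
proof -
  interpret monoid S by (rule S)
  have e: "embedding_map T T' f" and h: "f \<in> hom S S'"
    using f by (auto simp: top_monoid_embedding_def)
  have c: "continuous_map T T' f" by (rule embedding_mapD[OF e])
  have hom: "T homeomorphic_space subtopology T' (f ` topspace T)"
    by (rule embedding_map_imp_homeomorphic_space[OF e])
  have cS': "continuous_map (prod_topology T' T') T' (\<lambda>(s, t). s \<otimes>\<^bsub>S'\<^esub> t)"
    using S' by (simp add: topological_monoid_def)
  have "continuous_map (prod_topology T T) T' ((\<lambda>(s, t). s \<otimes>\<^bsub>S'\<^esub> t) \<circ> (\<lambda>(s, t). (f s, f t)))"
    using continuous_map_compose[OF _ cS'] continuous_map_prod_top[of T T T' T' f f] c by simp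
  then have "continuous_map (prod_topology T T) T' (\<lambda>x. f ((\<lambda>(s, t). s \<otimes>\<^bsub>S\<^esub> t) x))"
  proof (rule continuous_map_eq)
    fix x assume "x \<in> topspace (prod_topology T T)"
    then show "((\<lambda>(s, t). s \<otimes>\<^bsub>S'\<^esub> t) \<circ> (\<lambda>(s, t). (f s, f t))) x = f ((\<lambda>(s, t). s \<otimes>\<^bsub>S\<^esub> t) x)"
      using S h by (auto simp: hom_mult)
  qed
  then have "continuous_map (prod_topology T T) T (\<lambda>(s, t). s \<otimes>\<^bsub>S\<^esub> t)"
    by (rule continuous_map_into_embedding[OF e, rotated]) (use S in auto)
  then show ?thesis
    using S S' homeomorphic_completely_regular_space[OF hom] homeomorphic_Hausdorff_space[OF hom]
      completely_regular_space_subtopology Hausdorff_space_subtopology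
    unfolding topological_monoid_def by metis
qed

section \<open>Composition of self-maps in the pointwise topology\<close>

lemma self_map_monoid_simps [simp]:
  "carrier (self_map_monoid K) = K \<rightarrow>\<^sub>E K"
  "f \<otimes>\<^bsub>self_map_monoid K\<^esub> g = compose K f g"
  "\<one>\<^bsub>self_map_monoid K\<^esub> = (\<lambda>x\<in>K. x)"
  by (simp_all add: self_map_monoid_def)

lemma topological_monoid_self_map_monoid:
  "topological_monoid (self_map_monoid K) (pointwise_topology K)"
proof -
  have "monoid (self_map_monoid K)"
  proof
    fix f g h
    assume "f \<in> carrier (self_map_monoid K)" "g \<in> carrier (self_map_monoid K)"
      "h \<in> carrier (self_map_monoid K)"
    then show "f \<otimes>\<^bsub>self_map_monoid K\<^esub> g \<otimes>\<^bsub>self_map_monoid K\<^esub> h =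
      f \<otimes>\<^bsub>self_map_monoid K\<^esub> (g \<otimes>\<^bsub>self_map_monoid K\<^esub> h)"
      using compose_assoc[of h K K f g] by (simp add: PiE_iff Pi_iff)
  next
    fix f assume f: "f \<in> carrier (self_map_monoid K)"
    then show "\<one>\<^bsub>self_map_monoid K\<^esub> \<otimes>\<^bsub>self_map_monoid K\<^esub> f = f"
      using Id_compose[of f K K] by (simp add: PiE_iff Pi_iff)
    show "f \<otimes>\<^bsub>self_map_monoid K\<^esub> \<one>\<^bsub>self_map_monoid K\<^esub> = f"
      using f compose_Id[of f K K] by (simp add: PiE_iff Pi_iff)
  qed (auto simp: compose_def)
  moreover have "continuous_map (prod_topology (pointwise_topology K) (pointwise_topology K))
      (pointwise_topology K) (\<lambda>(f, g). compose K f g)"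
    unfolding pointwise_topology_def
  proof (rule continuous_map_into_discrete_power)
    fix x assume x: "x \<in> topspace (prod_topology (discrete_power K K) (discrete_power K K))"
    obtain f g where fg: "x = (f, g)" "f \<in> K \<rightarrow>\<^sub>E K" "g \<in> K \<rightarrow>\<^sub>E K"
      using x by auto
    show "(case x of (f, g) \<Rightarrow> compose K f g) \<in> K \<rightarrow>\<^sub>E K"
      using fg by (auto simp: compose_def PiE_iff)
    fix i assume i: "i \<in> K"
    then have gi: "g i \<in> K" using PiE_mem[OF fg(3)] by simp
    \<comment> \<open>The value of the composite at \<open>i\<close> depends only on
      \<open>g\<close> at \<open>i\<close> and on \<open>f\<close> at \<open>g i\<close>; the box
      fixes these two values.\<close>
    let ?U = "{f' \<in> K \<rightarrow>\<^sub>E K. \<forall>j\<in>{g i}. f' j = f j}" and ?V = "{g' \<in> K \<rightarrow>\<^sub>E K. \<forall>j\<in>{i}. g' j = g j}"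
    have "openin (prod_topology (discrete_power K K) (discrete_power K K)) (?U \<times> ?V)"
      unfolding openin_prod_Times_iff using i gi openin_cylinder[of "{g i}" K K f] openin_cylinder[of "{i}" K K g] by simp
    moreover have "x \<in> ?U \<times> ?V" using fg by simp
    moreover have "(case y of (f, g) \<Rightarrow> compose K f g) i = (case x of (f, g) \<Rightarrow> compose K f g) i"
      if "y \<in> ?U \<times> ?V" for y
      using that i fg by (auto simp: compose_def)
    ultimately show "\<exists>U. openin (prod_topology (discrete_power K K) (discrete_power K K)) U \<and> x \<in> U \<and>
        (\<forall>y\<in>U. (case y of (f, g) \<Rightarrow> compose K f g) i = (case x of (f, g) \<Rightarrow> compose K f g) i)"
      by (intro exI[of _ "?U \<times> ?V"] conjI ballI)
  qed
  ultimately show ?thesis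
    by (simp add: topological_monoid_def topspace_pointwise_topology pointwise_topology_def
        completely_regular_space_discrete_power Hausdorff_space_discrete_power)
qed

section \<open>The monoid of self-maps of a set\<close>

lemma openin_self_map_coordinate:
  assumes "continuous_map T (pointwise_topology K) \<phi>" "i \<in> K"
  shows "openin T {t \<in> topspace T. \<phi> t i = a}"
proof -
  have "continuous_map T (discrete_topology K) (\<lambda>t. \<phi> t i)"
    using assms by (simp add: pointwise_topology_def continuous_map_componentwise)
  then have "\<phi> t i \<in> K" if "t \<in> topspace T" for t
    using that by (auto simp: continuous_map_def)
  \<comment> \<open>The value \<open>a\<close> is arbitrary and may lie outside \<open>K\<close>,
    where its singleton is not open in \<open>discrete_topology K\<close>; hence the intersection
    with \<open>K\<close>.\<close>
  then have "{t \<in> topspace T. \<phi> t i \<in> K \<inter> {a}} = {t \<in> topspace T. \<phi> t i = a}"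
    by auto
  then show ?thesis
    using openin_continuous_map_preimage[OF \<open>continuous_map T _ (\<lambda>t. \<phi> t i)\<close>, of "K \<inter> {a}"] by simp
qed

text \<open>A self-map \<open>f\<close> of \<open>K\<close> is encoded by its graph, a point of the compact cube on \<open>K \<times> K\<close>;
  composition on the right extends to this cube as a substitution in the first coordinate.\<close>

lemma r_NA_if_embeds_self_map_monoid:
  assumes M: "topological_monoid S T"
    and emb: "top_monoid_embedding S T (self_map_monoid K) (pointwise_topology K) \<phi>"
  shows "r_NA S T"
proof -
  have TS: "topspace T = carrier S" and S: "monoid S" and HT: "Hausdorff_space T"
    using M by (auto simp: topological_monoid_def)
  interpret monoid S by (rule S)
  have e: "embedding_map T (pointwise_topology K) \<phi>" and h: "\<phi> \<in> hom S (self_map_monoid K)"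
    and one: "\<phi> \<one>\<^bsub>S\<^esub> = (\<lambda>x\<in>K. x)"
    using emb by (auto simp: top_monoid_embedding_def)
  note c = embedding_mapD(1)[OF e]
  have \<phi>: "\<phi> s \<in> K \<rightarrow>\<^sub>E K" if "s \<in> carrier S" for s
    using h that by (auto simp: hom_def)
  have \<phi>K: "\<phi> s i \<in> K" if "s \<in> carrier S" "i \<in> K" for s i
    using PiE_mem[OF \<phi>] that by blast
  have mult: "\<phi> (s \<otimes>\<^bsub>S\<^esub> t) i = \<phi> s (\<phi> t i)" if "s \<in> carrier S" "t \<in> carrier S" "i \<in> K" for s t i
    using hom_mult[OF h that(1,2)] that(3) by (simp add: compose_def)
  let ?P = "discrete_power (UNIV :: bool set) (K \<times> K)"
  define \<nu> where "\<nu> s = (\<lambda>(i, j)\<in>K \<times> K. \<phi> s i = j)" for s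
  \<comment> \<open>The closure makes the image dense. Its points need not be graphs: a row of a
    limit of graphs may be empty.\<close>
  define C where "C = Abstract_Topology.closure_of ?P (\<nu> ` carrier S)"
  define Y where "Y = subtopology ?P C"
  \<comment> \<open>If \<open>p\<close> is the graph of \<open>f\<close>, this is the graph of
    \<open>f\<close> after \<open>\<phi> s\<close>; the formula makes sense for any subset of
    \<open>K \<times> K\<close>.\<close>
  define act where "act p s = (\<lambda>(i, j)\<in>K \<times> K. p (\<phi> s i, j))" for p :: "'b \<times> 'b \<Rightarrow> bool" and s
  have \<nu>P: "\<nu> s \<in> topspace ?P" for s by (simp add: \<nu>_def)
  have CP: "C \<subseteq> topspace ?P" unfolding C_def by (rule closure_of_subset_topspace)
  have tY: "topspace Y = C" using CP by (auto simp: Y_def)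
  have actP: "act p s \<in> topspace ?P" for p s by (simp add: act_def)
  have act\<nu>: "act (\<nu> t) s = \<nu> (t \<otimes>\<^bsub>S\<^esub> s)" if "s \<in> carrier S" "t \<in> carrier S" for s t
    unfolding act_def \<nu>_def using that by (intro restrict_ext) (auto simp: mult \<phi>K)
  have contP: "continuous_map (prod_topology ?P T) ?P (\<lambda>(p, s). act p s)"
  proof (rule continuous_map_into_discrete_power)
    fix x assume "x \<in> topspace (prod_topology ?P T)"
    then show "(case x of (p, s) \<Rightarrow> act p s) \<in> K \<times> K \<rightarrow>\<^sub>E UNIV"
      using actP by (auto split: prod.splits)
  next
    fix k x assume k: "k \<in> K \<times> K" and x: "x \<in> topspace (prod_topology ?P T)"
    obtain i j where ij: "k = (i, j)" "i \<in> K" "j \<in> K" using k by auto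
    obtain p s where ps: "x = (p, s)" "p \<in> topspace ?P" "s \<in> carrier S" using x TS by auto
    \<comment> \<open>The coordinate \<open>(i, j)\<close> of \<open>act p s\<close> is determined
      by the value \<open>\<phi> s i\<close> and by one coordinate of \<open>p\<close>; fixing both
      gives joint continuity.\<close>
    let ?U = "{q \<in> K \<times> K \<rightarrow>\<^sub>E UNIV. \<forall>k\<in>{(\<phi> s i, j)}. q k = p k}"
    let ?V = "{t \<in> topspace T. \<phi> t i = \<phi> s i}"
    have "openin ?P ?U"
      using ij ps \<phi>K by (intro openin_cylinder) auto
    moreover have "openin T ?V"
      using ij by (intro openin_self_map_coordinate[OF c])
    ultimately have "openin (prod_topology ?P T) (?U \<times> ?V)"
      by (simp add: openin_prod_Times_iff)
    moreover have "x \<in> ?U \<times> ?V" using ps TS by simp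
    moreover have "(case y of (p, s) \<Rightarrow> act p s) k = (case x of (p, s) \<Rightarrow> act p s) k"
      if "y \<in> ?U \<times> ?V" for y
      using that ij ps by (auto simp: act_def)
    ultimately show "\<exists>U. openin (prod_topology ?P T) U \<and> x \<in> U \<and>
        (\<forall>y\<in>U. (case y of (p, s) \<Rightarrow> act p s) k = (case x of (p, s) \<Rightarrow> act p s) k)"
      by (intro exI[of _ "?U \<times> ?V"] conjI ballI)
  qed
  have invariant: "act p s \<in> C" if p: "p \<in> C" and s: "s \<in> carrier S" for p s
  proof -
    have "continuous_map ?P (prod_topology ?P T) (\<lambda>p. (p, s))"
      using s TS by (simp add: continuous_map_pairedI)
    from continuous_map_compose[OF this contP]
    have "continuous_map ?P ?P (\<lambda>p. act p s)" by (simp add: o_def)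
    then have "(\<lambda>p. act p s) ` C \<subseteq> Abstract_Topology.closure_of ?P ((\<lambda>p. act p s) ` \<nu> ` carrier S)"
      unfolding C_def by (rule continuous_map_image_closure_subset)
    also have "\<dots> \<subseteq> C"
      unfolding C_def using s by (intro closure_of_mono) (auto simp: act\<nu>)
    finally show ?thesis using p by blast
  qed
  have "continuous_map (prod_topology Y T) ?P (\<lambda>(p, s). act p s)"
    unfolding Y_def prod_topology_subtopology by (intro continuous_map_from_subtopology contP)
  then have contY: "continuous_map (prod_topology Y T) Y (\<lambda>(p, s). act p s)"
    using invariant TS tY by (subst (2) Y_def) (auto simp: continuous_map_in_subtopology)
  have "continuous_map T ?P \<nu>"
  proof (rule continuous_map_into_discrete_power)
    fix s assume "s \<in> topspace T"
    show "\<nu> s \<in> K \<times> K \<rightarrow>\<^sub>E UNIV" using \<nu>P by simp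
  next
    fix k s assume "k \<in> K \<times> K" and s: "s \<in> topspace T"
    then obtain i j where ij: "k = (i, j)" "i \<in> K" "j \<in> K" by auto
    have "openin T {t \<in> topspace T. \<phi> t i = \<phi> s i}"
      using ij by (intro openin_self_map_coordinate[OF c])
    moreover have "\<nu> t k = \<nu> s k" if "t \<in> {t \<in> topspace T. \<phi> t i = \<phi> s i}" for t
      using that ij by (simp add: \<nu>_def)
    moreover have "s \<in> {t \<in> topspace T. \<phi> t i = \<phi> s i}" using s by simp
    ultimately show "\<exists>U. openin T U \<and> s \<in> U \<and> (\<forall>t\<in>U. \<nu> t k = \<nu> s k)"
      by (intro exI[of _ "{t \<in> topspace T. \<phi> t i = \<phi> s i}"] conjI ballI)
  qed
  then have "embedding_map T ?P \<nu>"
  proof (rule embedding_mapI[OF _ HT])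
    fix U x assume U: "openin T U" "x \<in> U"
    then have xS: "x \<in> carrier S" using openin_subset TS by blast
    obtain V where V: "openin (pointwise_topology K) V" "\<And>y. y \<in> carrier S \<Longrightarrow> \<phi> y \<in> V \<longleftrightarrow> y \<in> U"
      using embedding_mapD(3)[OF e U(1)] TS by blast
    have "\<phi> x \<in> V" using V(2) xS U(2) by blast
    then obtain F where F: "finite F" "F \<subseteq> K"
        "\<And>f. f \<in> K \<rightarrow>\<^sub>E K \<Longrightarrow> \<forall>i\<in>F. f i = \<phi> x i \<Longrightarrow> f \<in> V"
      using bspec[OF conjunct2[OF V(1)[unfolded pointwise_topology_def openin_discrete_power]]
          \<open>\<phi> x \<in> V\<close>] by metis
    \<comment> \<open>These are the points of the graph of \<open>\<phi> x\<close> over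
      \<open>F\<close>, where \<open>\<nu> x\<close> is true. If \<open>\<nu> y\<close> is true
      there as well, then \<open>\<phi> y\<close> agrees with \<open>\<phi> x\<close> on
      \<open>F\<close>.\<close>
    let ?F = "(\<lambda>i. (i, \<phi> x i)) ` F"
    let ?V = "{p \<in> K \<times> K \<rightarrow>\<^sub>E UNIV. \<forall>k\<in>?F. p k = \<nu> x k}"
    have "openin ?P ?V"
      using F(1,2) xS \<phi>K by (intro openin_cylinder) auto
    moreover have "\<nu> x \<in> ?V" using \<nu>P by simp
    moreover have "y \<in> U" if y: "y \<in> topspace T" "\<nu> y \<in> ?V" for y
    proof -
      have "\<phi> y i = \<phi> x i" if i: "i \<in> F" for i
      proof -
        have "i \<in> K" "\<phi> x i \<in> K" using i F(2) \<phi>K xS by auto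
        moreover have "\<nu> y (i, \<phi> x i) = \<nu> x (i, \<phi> x i)" using y(2) i by blast
        ultimately show ?thesis by (simp add: \<nu>_def)
      qed
      then have "\<phi> y \<in> V" using F(3)[OF \<phi>] y(1) TS by simp
      then show ?thesis using V(2) y(1) TS by simp
    qed
    ultimately show "\<exists>V. openin ?P V \<and> \<nu> x \<in> V \<and> (\<forall>y\<in>topspace T. \<nu> y \<in> V \<longrightarrow> y \<in> U)"
      by (intro exI[of _ ?V] conjI ballI impI)
  qed
  moreover have \<nu>C: "\<nu> ` carrier S \<subseteq> C"
    unfolding C_def using \<nu>P by (intro closure_of_subset) blast
  ultimately have emb\<nu>: "embedding_map T Y \<nu>"
    unfolding Y_def embedding_map_in_subtopology using TS by simp
  have dense: "Abstract_Topology.closure_of Y (\<nu> ` topspace T) = topspace Y"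
    unfolding tY unfolding Y_def closure_of_subtopology TS
    using \<nu>C by (simp add: Int_absorb1 C_def[symmetric])
  have "right_NA_compactification S T Y act \<nu>"
    unfolding right_NA_compactification_def
  proof (intro conjI ballI)
    show "stone_space Y"
      unfolding Y_def C_def by (intro stone_space_closed_subspace_discrete_power) auto
    show "act y \<one>\<^bsub>S\<^esub> = y" if "y \<in> topspace Y" for y
    proof -
      have y: "y \<in> extensional (K \<times> K)" using that tY CP by (auto simp: PiE_iff)
      show ?thesis
        by (rule extensionalityI[OF _ y]) (auto simp: act_def one)
    qed
    show "act y (s \<otimes>\<^bsub>S\<^esub> t) = act (act y s) t"
      if "s \<in> carrier S" "t \<in> carrier S" "y \<in> topspace Y" for s t y
      unfolding act_def using that by (intro restrict_ext) (auto simp: mult \<phi>K)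
  qed (use contY emb\<nu> dense act\<nu> in auto)
  with M show ?thesis by (rule r_NA_I)
qed

text \<open>Each value is taken on a whole nonempty member of the base and can be read off there at
  an arbitrarily chosen point, so the base maps onto a set that contains all values.\<close>

lemma card_of_locally_constant_image:
  assumes B: "base_of_topology T \<B>"
    and f: "\<And>x. x \<in> topspace T \<Longrightarrow> \<exists>W. openin T W \<and> x \<in> W \<and> (\<forall>y\<in>W. f y = f x)"
  shows "(card_of (f ` topspace T), card_of \<B>) \<in> ordLeq"
proof (rule surj_imp_ordLeq[where f = "\<lambda>W. f (SOME x. x \<in> W)"], rule image_subsetI)
  fix x assume "x \<in> topspace T"
  then obtain W where W: "openin T W" "x \<in> W" "\<forall>y\<in>W. f y = f x" using f by metis
  then obtain V where V: "V \<in> \<B>" "x \<in> V" "V \<subseteq> W"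
    using B unfolding base_of_topology_def by meson
  then have "(SOME x. x \<in> V) \<in> V" by (meson someI)
  then have "f x = f (SOME x. x \<in> V)" using bspec[OF W(3)] V(3) by (metis subsetD)
  then show "f x \<in> (\<lambda>W. f (SOME x. x \<in> W)) ` \<B>" using V(1) by (rule image_eqI)
qed

text \<open>The preimage of \<open>b\<close> under the action of \<open>s\<close> is compact, so the
  tube lemma widens \<open>s\<close> to a neighbourhood that still moves this preimage into
  \<open>b\<close>. The same for the complement of \<open>b\<close> yields equality of the
  preimages.\<close>

lemma clopen_preimage_locally_constant:
  assumes c: "continuous_map (prod_topology Y T) Y (\<lambda>(y, s). act y s)"
    and Y: "compact_space Y" and b: "openin Y b" "closedin Y b" and s: "s \<in> topspace T"
  shows "\<exists>W. openin T W \<and> s \<in> W \<and>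
    (\<forall>t\<in>W. {y \<in> topspace Y. act y t \<in> b} = {y \<in> topspace Y. act y s \<in> b})"
proof -
  have tube: "\<exists>W. openin T W \<and> s \<in> W \<and> (\<forall>t\<in>W. \<forall>y\<in>topspace Y. act y s \<in> b \<longrightarrow> act y t \<in> b)"
    if b: "openin Y b" "closedin Y b" for b
  proof -
    let ?D = "{x \<in> topspace (prod_topology Y T). (\<lambda>(y, s). act y s) x \<in> b}"
    let ?c = "{y \<in> topspace Y. act y s \<in> b}"
    have "continuous_map Y (prod_topology Y T) (\<lambda>y. (y, s))"
      using s by (simp add: continuous_map_pairedI)
    from continuous_map_compose[OF this c] have "continuous_map Y Y (\<lambda>y. act y s)"
      by (simp add: o_def)
    then have "closedin Y ?c" by (rule closedin_continuous_map_preimage) (rule b)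
    then have "compactin Y ?c" using Y closedin_compact_space by blast
    moreover have "openin (prod_topology Y T) ?D"
      using openin_continuous_map_preimage[OF c b(1)] .
    moreover have "?c \<times> {s} \<subseteq> ?D" using s by auto
    ultimately obtain U W where UW: "openin T W" "?c \<subseteq> U" "s \<in> W" "U \<times> W \<subseteq> ?D"
      using tube_lemma_left[of Y T ?D ?c s] s by auto
    have "act y t \<in> b" if "t \<in> W" "y \<in> topspace Y" "act y s \<in> b" for t y
    proof -
      have "(y, t) \<in> ?D" using that UW(2) by (intro subsetD[OF UW(4)]) auto
      then show ?thesis by simp
    qed
    then show ?thesis using UW(1,3) by (intro exI[of _ W] conjI ballI impI)
  qed
  obtain W where W: "openin T W" "s \<in> W"
      "\<And>t y. t \<in> W \<Longrightarrow> y \<in> topspace Y \<Longrightarrow> act y s \<in> b \<Longrightarrow> act y t \<in> b"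
    using tube[OF b] by auto
  \<comment> \<open>The tube for the complement supplies the reverse inclusion; this is where
    \<open>b\<close> has to be clopen and not merely closed or open.\<close>
  obtain W' where W': "openin T W'" "s \<in> W'" "\<And>t y. t \<in> W' \<Longrightarrow> y \<in> topspace Y \<Longrightarrow>
      act y s \<in> topspace Y - b \<Longrightarrow> act y t \<in> topspace Y - b"
    using tube[of "topspace Y - b"] b by (metis closedin_diff closedin_topspace openin_diff openin_topspace)
  have top: "act y s \<in> topspace Y" if "y \<in> topspace Y" for y
    using c s that by (auto simp: continuous_map_def Pi_iff)
  have "{y \<in> topspace Y. act y t \<in> b} = {y \<in> topspace Y. act y s \<in> b}" if "t \<in> W \<inter> W'" for t
    using that W(3)[of t] W'(3)[of t] top by blast
  moreover have "openin T (W \<inter> W')" "s \<in> W \<inter> W'" using W(1,2) W'(1,2) by auto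
  ultimately show ?thesis by (intro exI[of _ "W \<inter> W'"] conjI ballI)
qed

text \<open>The clopen sets \<open>b\<close> of the compactification carry the left action \<open>s \<cdot> b = {y. y s \<in> b}\<close>.\<close>

lemma r_NA_embeds_in_self_map_monoid:
  fixes S :: "'a monoid" and K :: "'k set"
  assumes NA: "r_NA S T" and B: "base_of_topology T \<B>"
    and card_B: "(card_of \<B>, card_of K) \<in> ordLeq" and K: "infinite K"
  shows "embeds_as_top_monoid S T (self_map_monoid K) (pointwise_topology K)"
proof -
  have M: "topological_monoid S T" using NA by (simp add: r_NA_def)
  have TS: "topspace T = carrier S" and S: "monoid S" and HT: "Hausdorff_space T"
    using M by (auto simp: topological_monoid_def)
  interpret monoid S by (rule S)
  obtain Y :: "'a set set topology" and act \<nu> where C: "right_NA_compactification S T Y act \<nu>"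
    using NA unfolding r_NA_def by blast
  have Y: "stone_space Y" and e: "embedding_map T Y \<nu>"
    and ca: "continuous_map (prod_topology Y T) Y (\<lambda>(y, s). act y s)"
    and ao: "\<And>y. y \<in> topspace Y \<Longrightarrow> act y \<one>\<^bsub>S\<^esub> = y"
    and am: "\<And>s t y. \<lbrakk>s \<in> carrier S; t \<in> carrier S; y \<in> topspace Y\<rbrakk>
        \<Longrightarrow> act y (s \<otimes>\<^bsub>S\<^esub> t) = act (act y s) t"
    and eq: "\<And>s t. \<lbrakk>s \<in> carrier S; t \<in> carrier S\<rbrakk> \<Longrightarrow> \<nu> (t \<otimes>\<^bsub>S\<^esub> s) = act (\<nu> t) s"
    using C unfolding right_NA_compactification_def by auto
  have Yc: "compact_space Y" using Y by (simp add: stone_space_def)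
  obtain \<C> where base: "base_of_topology Y \<C>" and closed: "\<And>V. V \<in> \<C> \<Longrightarrow> closedin Y V"
    using Y unfolding stone_space_def by blast
  have actin: "act y s \<in> topspace Y" if "y \<in> topspace Y" "s \<in> carrier S" for s y
    using ca that TS by (auto simp: continuous_map_def Pi_iff)
  have \<nu>in: "\<nu> s \<in> topspace Y" if "s \<in> carrier S" for s
    using embedding_map_subset[OF e] that TS by blast
  define clopen where "clopen b \<longleftrightarrow> openin Y b \<and> closedin Y b" for b
  define pull where "pull s b = {y \<in> topspace Y. act y s \<in> b}" for s b
  have pull_lc: "\<exists>W. openin T W \<and> s \<in> W \<and> (\<forall>t\<in>W. pull t b = pull s b)"
    if "clopen b" "s \<in> carrier S" for s b
    using clopen_preimage_locally_constant[OF ca Yc, of b s] that TS by (simp add: pull_def clopen_def)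
  have clopen_pull: "clopen (pull s b)" if "clopen b" "s \<in> carrier S" for s b
  proof -
    have "continuous_map Y (prod_topology Y T) (\<lambda>y. (y, s))"
      using that TS by (simp add: continuous_map_pairedI)
    from continuous_map_compose[OF this ca] have "continuous_map Y Y (\<lambda>y. act y s)"
      by (simp add: o_def)
    then show ?thesis
      using that openin_continuous_map_preimage closedin_continuous_map_preimage
      unfolding clopen_def pull_def by blast
  qed
  have pull_one: "pull \<one>\<^bsub>S\<^esub> b = b" if "clopen b" for b
    using that closedin_subset[of Y b] ao by (auto simp: pull_def clopen_def subset_iff)
  have pull_mult: "pull (s \<otimes>\<^bsub>S\<^esub> t) b = pull s (pull t b)"
    if "s \<in> carrier S" "t \<in> carrier S" for s t b
    using that by (auto simp: pull_def am actin)
  define between where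
    "between P Q b \<longleftrightarrow> clopen b \<and> P \<subseteq> {x \<in> topspace T. \<nu> x \<in> b} \<and> {x \<in> topspace T. \<nu> x \<in> b} \<subseteq> Q"
    for P Q b
  \<comment> \<open>One clopen set is chosen for each pair of base members that some clopen set
    separates. This leaves at most as many sets as there are pairs, hence at most
    \<open>|K|\<close>, however large \<open>Y\<close> is.\<close>
  define \<V> where "\<V> = (\<lambda>(P, Q). SOME b. between P Q b) ` {(P, Q) \<in> \<B> \<times> \<B>. \<exists>b. between P Q b}"
  have \<V>_clopen: "clopen b" if b: "b \<in> \<V>" for b
  proof -
    obtain P Q where PQ: "\<exists>b. between P Q b" "b = (SOME b. between P Q b)"
      using b unfolding \<V>_def by auto
    then have "between P Q b" using someI_ex[OF PQ(1)] by simp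
    then show ?thesis by (simp add: between_def)
  qed
  \<comment> \<open>The union of the orbits of the chosen sets is invariant by
    \<open>pull_mult\<close>. Each orbit is the image of a locally constant map, so it is no larger
    than the base.\<close>
  define \<Phi> where "\<Phi> = (\<Union>b\<in>\<V>. (\<lambda>s. pull s b) ` topspace T)"
  have \<Phi>_clopen: "clopen b" if "b \<in> \<Phi>" for b
    using that \<V>_clopen clopen_pull TS unfolding \<Phi>_def by auto
  have \<Phi>_pull: "pull s b \<in> \<Phi>" if b: "b \<in> \<Phi>" and s: "s \<in> carrier S" for s b
  proof -
    obtain b0 t where b0: "b0 \<in> \<V>" "t \<in> carrier S" "b = pull t b0"
      using b TS unfolding \<Phi>_def by auto
    then have "pull s b = pull (s \<otimes>\<^bsub>S\<^esub> t) b0" using pull_mult s by simp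
    then show ?thesis using b0 s TS unfolding \<Phi>_def by auto
  qed
  have \<V>\<Phi>: "\<V> \<subseteq> \<Phi>"
  proof
    fix b assume b: "b \<in> \<V>"
    then have "b = pull \<one>\<^bsub>S\<^esub> b" using pull_one \<V>_clopen by simp
    then show "b \<in> \<Phi>" using b TS unfolding \<Phi>_def by blast
  qed
  have "(card_of \<V>, card_of (\<B> \<times> \<B>)) \<in> ordLeq"
    unfolding \<V>_def by (rule ordLeq_transitive[OF card_of_image card_of_mono1]) auto
  moreover have "(card_of (\<B> \<times> \<B>), card_of K) \<in> ordLeq"
    using K card_B by (intro card_of_Sigma_ordLeq_infinite) auto
  ultimately have "(card_of \<V>, card_of K) \<in> ordLeq" by (rule ordLeq_transitive)
  moreover have "(card_of ((\<lambda>s. pull s b) ` topspace T), card_of K) \<in> ordLeq" if "b \<in> \<V>" for b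
  proof (intro ordLeq_transitive[OF card_of_locally_constant_image[OF B] card_B])
    fix s assume "s \<in> topspace T"
    then show "\<exists>W. openin T W \<and> s \<in> W \<and> (\<forall>t\<in>W. pull t b = pull s b)"
      using TS by (intro pull_lc[OF \<V>_clopen[OF that]]) simp
  qed
  ultimately have "(card_of \<Phi>, card_of K) \<in> ordLeq"
    unfolding \<Phi>_def using K by (intro card_of_UNION_ordLeq_infinite) auto
  then obtain g where g: "inj_on g \<Phi>" "g ` \<Phi> \<subseteq> K"
    unfolding card_of_ordLeq[symmetric] by blast
  \<comment> \<open>The action on \<open>\<Phi>\<close> is transported along the injection
    \<open>g\<close>. Points of \<open>K\<close> that \<open>g\<close> misses are fixed by every
    \<open>s\<close>, which respects products and the identity.\<close>
  define \<phi> where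
    "\<phi> s = (\<lambda>k\<in>K. if k \<in> g ` \<Phi> then g (pull s (inv_into \<Phi> g k)) else k)" for s
  have \<phi>g: "\<phi> s (g b) = g (pull s b)" if "b \<in> \<Phi>" for s b
    using that g by (auto simp: \<phi>_def)
  have \<phi>n: "\<phi> s k = k" if "k \<in> K" "k \<notin> g ` \<Phi>" for s k
    using that by (simp add: \<phi>_def)
  have \<phi>K: "\<phi> s \<in> K \<rightarrow>\<^sub>E K" if s: "s \<in> carrier S" for s
  proof (rule PiE_I)
    fix k assume k: "k \<in> K"
    show "\<phi> s k \<in> K"
    proof (cases "k \<in> g ` \<Phi>")
      case True
      then obtain b where "b \<in> \<Phi>" "k = g b" by blast
      then show ?thesis using \<phi>g \<Phi>_pull[OF _ s] g(2) by auto
    qed (use k \<phi>n in simp)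
  qed (simp add: \<phi>_def)
  have \<phi>mult: "\<phi> (s \<otimes>\<^bsub>S\<^esub> t) = compose K (\<phi> s) (\<phi> t)" if st: "s \<in> carrier S" "t \<in> carrier S" for s t
  proof (rule extensionalityI[of _ K])
    fix k assume k: "k \<in> K"
    show "\<phi> (s \<otimes>\<^bsub>S\<^esub> t) k = compose K (\<phi> s) (\<phi> t) k"
    proof (cases "k \<in> g ` \<Phi>")
      case True
      then obtain b where b: "b \<in> \<Phi>" "k = g b" by blast
      have "pull t b \<in> \<Phi>" using \<Phi>_pull b st by blast
      then show ?thesis using k b st by (simp add: compose_def \<phi>g pull_mult)
    next
      case False
      then show ?thesis using k by (simp add: compose_def \<phi>n)
    qed
  qed (simp_all add: \<phi>_def)
  have \<phi>one: "\<phi> \<one>\<^bsub>S\<^esub> = (\<lambda>k\<in>K. k)"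
  proof (rule extensionalityI[of _ K])
    fix k assume k: "k \<in> K"
    show "\<phi> \<one>\<^bsub>S\<^esub> k = (\<lambda>k\<in>K. k) k"
    proof (cases "k \<in> g ` \<Phi>")
      case True
      then obtain b where "b \<in> \<Phi>" "k = g b" by blast
      then show ?thesis using k \<phi>g pull_one \<Phi>_clopen by simp
    next
      case False
      then show ?thesis using k by (simp add: \<phi>n)
    qed
  qed (simp_all add: \<phi>_def)
  have "continuous_map T (pointwise_topology K) \<phi>"
    unfolding pointwise_topology_def
  proof (rule continuous_map_into_discrete_power)
    fix s assume "s \<in> topspace T"
    then show "\<phi> s \<in> K \<rightarrow>\<^sub>E K" using \<phi>K TS by simp
  next
    fix k s assume k: "k \<in> K" and s: "s \<in> topspace T"
    show "\<exists>U. openin T U \<and> s \<in> U \<and> (\<forall>t\<in>U. \<phi> t k = \<phi> s k)"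
    proof (cases "k \<in> g ` \<Phi>")
      case True
      then obtain b where b: "b \<in> \<Phi>" "k = g b" by blast
      obtain W where W: "openin T W" "s \<in> W" "\<And>t. t \<in> W \<Longrightarrow> pull t b = pull s b"
        using pull_lc[OF \<Phi>_clopen[OF b(1)]] s TS by metis
      have "\<phi> t k = \<phi> s k" if "t \<in> W" for t
        using \<phi>g[OF b(1)] W(3)[OF that] b(2) by simp
      then show ?thesis using W(1,2) by (intro exI[of _ W] conjI ballI)
    next
      case False
      then show ?thesis using \<phi>n[OF k] s by (intro exI[of _ "topspace T"]) auto
    qed
  qed
  then have "embedding_map T (pointwise_topology K) \<phi>"
  proof (rule embedding_mapI[OF _ HT])
    fix U x assume U: "openin T U" "x \<in> U"
    then have xS: "x \<in> carrier S" using openin_subset TS by blast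
    \<comment> \<open>First \<open>Q\<close> inside \<open>U\<close>, then a clopen \<open>c\<close>
      around \<open>\<nu> x\<close> whose trace lies in \<open>Q\<close>, then \<open>P\<close>
      around \<open>x\<close> inside that trace: the pair \<open>(P, Q)\<close> is separated by
      \<open>c\<close>.\<close>
    obtain Q where Q: "Q \<in> \<B>" "x \<in> Q" "Q \<subseteq> U" "openin T Q"
      using B U unfolding base_of_topology_def by meson
    obtain V where V: "openin Y V" "\<forall>y\<in>topspace T. \<nu> y \<in> V \<longleftrightarrow> y \<in> Q"
      using embedding_mapD(3)[OF e Q(4)] by blast
    then have "\<nu> x \<in> V" using Q(2) xS TS by blast
    then obtain c where c: "c \<in> \<C>" "\<nu> x \<in> c" "c \<subseteq> V" "openin Y c"
      using base V(1) unfolding base_of_topology_def by meson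
    have "openin T {y \<in> topspace T. \<nu> y \<in> c}"
      using openin_continuous_map_preimage[OF embedding_mapD(1)[OF e] c(4)] .
    then obtain P where P: "P \<in> \<B>" "x \<in> P" "P \<subseteq> {y \<in> topspace T. \<nu> y \<in> c}"
      using B c(2) xS TS unfolding base_of_topology_def by (metis (mono_tags, lifting) mem_Collect_eq)
    have "between P Q c"
      using P c V(2) closed unfolding between_def clopen_def by blast
    \<comment> \<open>The chosen \<open>b\<close> may differ from \<open>c\<close>, but it lies
      between the same \<open>P\<close> and \<open>Q\<close>, so it still separates \<open>x\<close>
      from the complement of \<open>U\<close>.\<close>
    define b where "b = (SOME b. between P Q b)"
    have b: "between P Q b" using \<open>between P Q c\<close> unfolding b_def by (rule someI)
    have "b \<in> \<V>"
      unfolding \<V>_def b_def using P(1) Q(1) \<open>between P Q c\<close> by (intro image_eqI[of _ _ "(P, Q)"]) auto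
    then have b\<Phi>: "b \<in> \<Phi>" using \<V>\<Phi> by blast
    \<comment> \<open>Acting on the image of the identity recovers \<open>\<nu> y\<close>. Equality
      of \<open>pull y b\<close> and \<open>pull x b\<close> therefore forces
      \<open>\<nu> y \<in> b\<close>, and one coordinate makes a suitable neighbourhood.\<close>
    have mem: "\<nu> \<one>\<^bsub>S\<^esub> \<in> pull y b \<longleftrightarrow> \<nu> y \<in> b" if "y \<in> carrier S" for y
      using that eq[of y "\<one>\<^bsub>S\<^esub>"] \<nu>in by (simp add: pull_def)
    let ?W = "{f \<in> K \<rightarrow>\<^sub>E K. \<forall>i\<in>{g b}. f i = \<phi> x i}"
    have "openin (pointwise_topology K) ?W"
      unfolding pointwise_topology_def using b\<Phi> g(2) by (intro openin_cylinder) auto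
    moreover have "\<phi> x \<in> ?W" using \<phi>K xS by simp
    moreover have "y \<in> U" if y: "y \<in> topspace T" "\<phi> y \<in> ?W" for y
    proof -
      have yS: "y \<in> carrier S" using y TS by simp
      have "g (pull y b) = g (pull x b)" using y(2) by (simp add: \<phi>g b\<Phi>)
      then have "pull y b = pull x b"
        using g(1) \<Phi>_pull b\<Phi> yS xS by (meson inj_onD)
      moreover have "\<nu> x \<in> b" using b P(2) unfolding between_def by blast
      ultimately have "\<nu> y \<in> b" using mem yS xS by blast
      then show ?thesis using b y(1) Q(3) unfolding between_def by blast
    qed
    ultimately show "\<exists>V. openin (pointwise_topology K) V \<and> \<phi> x \<in> V \<and>
        (\<forall>y\<in>topspace T. \<phi> y \<in> V \<longrightarrow> y \<in> U)"
      by (intro exI[of _ ?W] conjI ballI impI)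
  qed
  then have "top_monoid_embedding S T (self_map_monoid K) (pointwise_topology K) \<phi>"
    unfolding top_monoid_embedding_def hom_def using \<phi>K \<phi>mult \<phi>one by simp
  then show ?thesis unfolding embeds_as_top_monoid_def by blast
qed

section \<open>Weight and countable bases\<close>

text \<open>Cylinders are built in stages, one equation \<open>f i = a\<close> at a time. Each stage
  is an image of the previous one times \<open>I \<times> A\<close>, so it has at most
  \<open>|K|\<close> members, and the union over all natural numbers keeps this bound.\<close>

lemma discrete_power_base:
  fixes K :: "'k set"
  assumes K: "infinite K" and A: "(card_of A, card_of K) \<in> ordLeq" and I: "(card_of I, card_of K) \<in> ordLeq"
  shows "\<exists>\<B>. base_of_topology (discrete_power A I) \<B> \<and> (card_of \<B>, card_of K) \<in> ordLeq"
proof -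
  define B where "B = rec_nat {I \<rightarrow>\<^sub>E A} (\<lambda>_ \<C>. (\<lambda>(b, i, a). {f \<in> b. f i = a}) ` (\<C> \<times> I \<times> A))"
  have B0: "B 0 = {I \<rightarrow>\<^sub>E A}" and BS: "B (Suc n) = (\<lambda>(b, i, a). {f \<in> b. f i = a}) ` (B n \<times> I \<times> A)" for n
    by (simp_all add: B_def)
  have card: "(card_of (B n), card_of K) \<in> ordLeq" for n
  proof (induction n)
    case 0
    have "(card_of {I \<rightarrow>\<^sub>E A}, card_of K) \<in> ordLeq"
      using K by (intro card_of_singl_ordLeq) auto
    then show ?case by (simp add: B0)
  next
    case (Suc n)
    have "(card_of (B n \<times> I \<times> A), card_of K) \<in> ordLeq"
      using K A I Suc by (intro card_of_Sigma_ordLeq_infinite ballI)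
    then show ?case unfolding BS by (rule ordLeq_transitive[OF card_of_image])
  qed
  have opn: "openin (discrete_power A I) b" if "b \<in> B n" for n b
    using that
  proof (induction n arbitrary: b)
    case 0
    then show ?case using openin_topspace[of "discrete_power A I"] by (simp add: B0)
  next
    case (Suc n)
    then obtain c i a where c: "c \<in> B n" "i \<in> I" "b = {f \<in> c. f i = a}"
      unfolding BS by auto
    have "openin (discrete_power A I) c" using Suc.IH c(1) .
    moreover have "b = c \<inter> {f \<in> I \<rightarrow>\<^sub>E A. f i = a}"
      using c(3) openin_subset[OF calculation] by auto
    moreover have "openin (discrete_power A I) {f \<in> I \<rightarrow>\<^sub>E A. f i = a}"
      using clopen_coordinate(1)[OF c(2), of A "\<lambda>x. x = a"] .
    ultimately show ?case by (simp add: openin_Int)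
  qed
  have cyl: "\<exists>n. {f \<in> I \<rightarrow>\<^sub>E A. \<forall>i\<in>F. f i = x i} \<in> B n"
    if "finite F" "F \<subseteq> I" "x \<in> I \<rightarrow>\<^sub>E A" for F x
    using that
  proof (induction F rule: finite_induct)
    case empty
    then show ?case by (intro exI[of _ 0]) (simp add: B0)
  next
    case (insert i F)
    then obtain n where n: "{f \<in> I \<rightarrow>\<^sub>E A. \<forall>i\<in>F. f i = x i} \<in> B n" by auto
    have "x i \<in> A" "i \<in> I" using insert.prems by auto
    then have "{f \<in> I \<rightarrow>\<^sub>E A. \<forall>i\<in>insert i F. f i = x i} \<in> B (Suc n)"
      unfolding BS using n
      by (intro image_eqI[of _ _ "({f \<in> I \<rightarrow>\<^sub>E A. \<forall>i\<in>F. f i = x i}, i, x i)"]) auto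
    then show ?case by blast
  qed
  have "base_of_topology (discrete_power A I) (\<Union>n. B n)"
    unfolding base_of_topology_def
  proof (intro conjI ballI allI impI)
    fix U x assume U: "openin (discrete_power A I) U \<and> x \<in> U"
    then have x: "x \<in> I \<rightarrow>\<^sub>E A" using openin_subset by fastforce
    obtain F where F: "finite F" "F \<subseteq> I" "\<forall>y\<in>I \<rightarrow>\<^sub>E A. (\<forall>i\<in>F. y i = x i) \<longrightarrow> y \<in> U"
      using U unfolding openin_discrete_power by meson
    obtain n where "{f \<in> I \<rightarrow>\<^sub>E A. \<forall>i\<in>F. f i = x i} \<in> B n"
      using cyl F x by blast
    then show "\<exists>V\<in>\<Union>n. B n. x \<in> V \<and> V \<subseteq> U"
      using F(3) x by (intro bexI[of _ "{f \<in> I \<rightarrow>\<^sub>E A. \<forall>i\<in>F. f i = x i}"]) auto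
  qed (use opn in blast)
  moreover have "(card_of (\<Union>n. B n), card_of K) \<in> ordLeq"
    using K card by (intro card_of_UNION_ordLeq_infinite) (auto simp: infinite_iff_card_of_nat[symmetric])
  ultimately show ?thesis by blast
qed

text \<open>For a fixed \<open>i\<close> the sets of all \<open>f\<close> with
  \<open>f i = j\<close>, with \<open>j\<close> in \<open>K\<close>, are disjoint, open and nonempty
  (they contain a constant map). Each includes a base member, and evaluating a chosen element of
  that member at \<open>i\<close> returns \<open>j\<close>.\<close>

lemma card_of_base_pointwise_topology:
  assumes "K \<noteq> {}" and B: "base_of_topology (pointwise_topology K) \<B>"
  shows "(card_of K, card_of \<B>) \<in> ordLeq"
proof -
  obtain i where i: "i \<in> K" using assms(1) by blast
  show ?thesis
  proof (rule surj_imp_ordLeq[where f = "\<lambda>V. (SOME f. f \<in> V) i"], rule subsetI)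
    fix j assume j: "j \<in> K"
    have "openin (pointwise_topology K) {f \<in> K \<rightarrow>\<^sub>E K. f i = j}"
      unfolding pointwise_topology_def using clopen_coordinate(1)[OF i, of K "\<lambda>x. x = j"] .
    moreover have "(\<lambda>_\<in>K. j) \<in> {f \<in> K \<rightarrow>\<^sub>E K. f i = j}" using i j by simp
    ultimately obtain V where V: "V \<in> \<B>" "(\<lambda>_\<in>K. j) \<in> V" "V \<subseteq> {f \<in> K \<rightarrow>\<^sub>E K. f i = j}"
      using B unfolding base_of_topology_def by meson
    have "(SOME f. f \<in> V) \<in> V" using someI[of "\<lambda>f. f \<in> V", OF V(2)] .
    then have "j = (SOME f. f \<in> V) i" using V(3) by blast
    then show "j \<in> (\<lambda>V. (SOME f. f \<in> V) i) ` \<B>" using V(1) by (rule image_eqI)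
  qed
qed

lemma has_weight_pointwise_topology:
  assumes "Cinfinite \<kappa>"
  shows "has_weight (pointwise_topology (Field \<kappa>)) \<kappa>"
proof -
  have K: "infinite (Field \<kappa>)" and iso: "(card_of (Field \<kappa>), \<kappa>) \<in> ordIso"
    using assms by (auto simp: cinfinite_def intro: card_of_Field_ordIso)
  have lower: "(\<kappa>, card_of \<B>) \<in> ordLeq" if "base_of_topology (pointwise_topology (Field \<kappa>)) \<B>" for \<B>
    using K by (intro ordIso_ordLeq_trans[OF ordIso_symmetric[OF iso]]
        card_of_base_pointwise_topology[OF _ that]) auto
  obtain \<B> where B: "base_of_topology (pointwise_topology (Field \<kappa>)) \<B>"
    "(card_of \<B>, card_of (Field \<kappa>)) \<in> ordLeq"
    using discrete_power_base[OF K ordLeq_refl[OF card_of_Card_order] ordLeq_refl[OF card_of_Card_order]]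
    unfolding pointwise_topology_def by blast
  have "(card_of \<B>, \<kappa>) \<in> ordLeq" using B(2) iso by (rule ordLeq_ordIso_trans)
  then have "(card_of \<B>, \<kappa>) \<in> ordIso" using lower[OF B(1)] by (simp add: ordIso_iff_ordLeq)
  then show ?thesis unfolding has_weight_def using B(1) lower by blast
qed

section \<open>Countable bases, Polish powers and separable metrizable spaces\<close>

lemma countable_iff_card_of_ordLeq:
  "countable A \<longleftrightarrow> (card_of A, card_of (UNIV :: nat set)) \<in> ordLeq"
  unfolding countable_def card_of_ordLeq[symmetric] by auto

lemma discrete_power_countable_base:
  assumes "countable A" "countable I"
  shows "\<exists>\<B>. base_of_topology (discrete_power A I) \<B> \<and> countable \<B>"
  using discrete_power_base[of "UNIV :: nat set" A I] assms infinite_UNIV_nat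
  by (simp add: countable_iff_card_of_ordLeq)

lemma polish_topology_discrete_power:
  assumes "countable A" "countable I"
  shows "polish_topology (discrete_power A I)"
proof -
  have "second_countable (discrete_power A I)"
    using discrete_power_countable_base[OF assms]
    unfolding second_countable_def base_of_topology_def by auto
  then have "separable_space (discrete_power A I)"
    by (rule second_countable_imp_separable_space)
  moreover have "countable {i \<in> I. \<not> (\<exists>a. topspace (discrete_topology A) \<subseteq> {a})}"
    using assms(2) by (rule countable_subset[rotated]) auto
  then have "completely_metrizable_space (discrete_power A I)"
    by (simp add: completely_metrizable_space_product_topology completely_metrizable_space_discrete_topology)
  ultimately show ?thesis by (simp add: polish_topology_def)
qed

lemma separable_metrizable_countable_base:
  assumes sep: "separable_space T" and met: "metrizable_space T"
  shows "\<exists>\<B>. base_of_topology T \<B> \<and> countable \<B>"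
proof -
  obtain M d where Md: "Metric_space M d" and T: "T = Metric_space.mtopology M d"
    using met unfolding metrizable_space_def by blast
  interpret Metric_space M d by (rule Md)
  obtain C where C: "countable C" "C \<subseteq> M" "Abstract_Topology.closure_of mtopology C = M"
    using sep unfolding separable_space_def T by auto
  define \<B> where "\<B> = (\<lambda>(x, n). mball x (inverse (real (Suc n)))) ` (C \<times> UNIV)"
  have "countable \<B>" unfolding \<B>_def using C(1) by (intro countable_image countable_SIGMA) auto
  moreover have "base_of_topology T \<B>"
    unfolding base_of_topology_def T
  proof (intro conjI ballI allI impI)
    fix V assume "V \<in> \<B>"
    then show "openin mtopology V" unfolding \<B>_def by auto
  next
    fix U y assume U: "openin mtopology U \<and> y \<in> U"
    then obtain r where r: "r > 0" "mball y r \<subseteq> U" and yM: "y \<in> M"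
      unfolding openin_mtopology by blast
    \<comment> \<open>A ball of this radius around a point of \<open>C\<close> that is equally close
      to \<open>y\<close> stays within distance \<open>r\<close> of \<open>y\<close>.\<close>
    obtain n where n: "inverse (real (Suc n)) < r / 2"
      using reals_Archimedean[of "r / 2"] r(1) by auto
    let ?e = "inverse (real (Suc n))"
    have "openin mtopology (mball y ?e)" "y \<in> mball y ?e" using yM by auto
    moreover have "y \<in> Abstract_Topology.closure_of mtopology C" using C(3) yM by simp
    ultimately obtain x where x: "x \<in> C" "x \<in> mball y ?e" unfolding in_closure_of by blast
    have "mball x ?e \<subseteq> mball y r"
    proof
      fix z assume z: "z \<in> mball x ?e"
      have "d y z \<le> d y x + d x z" using z x(2) yM by (intro triangle) auto
      also have "\<dots> < r" using z x(2) n by auto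
      finally show "z \<in> mball y r" using z yM by auto
    qed
    moreover have "y \<in> mball x ?e" using x(2) by (auto simp: commute)
    ultimately show "\<exists>V\<in>\<B>. y \<in> V \<and> V \<subseteq> U"
      using x(1) r(2) unfolding \<B>_def by (intro bexI[of _ "mball x ?e"]) auto
  qed
  ultimately show ?thesis by blast
qed

section \<open>Continuous self-maps of a Stone space\<close>

text \<open>The neighbourhood condition survives binary intersections and arbitrary unions, so
  checking it on generators is enough. The compact-open topology is only given by such
  generators.\<close>

lemma embedding_mapI_subbase:
  assumes f: "continuous_map (topology_generated_by \<S>) Y f"
    and T: "Hausdorff_space (topology_generated_by \<S>)"
    and initial: "\<And>U x. U \<in> \<S> \<Longrightarrow> x \<in> U \<Longrightarrow>
      \<exists>V. openin Y V \<and> f x \<in> V \<and> (\<forall>x'\<in>\<Union>\<S>. f x' \<in> V \<longrightarrow> x' \<in> U)"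
  shows "embedding_map (topology_generated_by \<S>) Y f"
proof (rule embedding_mapI[OF f T])
  fix U x assume "openin (topology_generated_by \<S>) U" "x \<in> U"
  then have "generate_topology_on \<S> U" by (simp add: openin_topology_generated_by)
  then have "\<exists>V. openin Y V \<and> f x \<in> V \<and> (\<forall>x'\<in>\<Union>\<S>. f x' \<in> V \<longrightarrow> x' \<in> U)" if "x \<in> U" for x
    using that
  proof (induction arbitrary: x)
    case Empty
    then show ?case by simp
  next
    case (Int a b)
    obtain V where V: "openin Y V" "f x \<in> V" "\<forall>x'\<in>\<Union>\<S>. f x' \<in> V \<longrightarrow> x' \<in> a"
      using Int.IH(1) Int.prems by (metis IntD1)
    obtain W where W: "openin Y W" "f x \<in> W" "\<forall>x'\<in>\<Union>\<S>. f x' \<in> W \<longrightarrow> x' \<in> b"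
      using Int.IH(2) Int.prems by (metis IntD2)
    show ?case using V W by (intro exI[of _ "V \<inter> W"]) (simp add: openin_Int)
  next
    case (UN \<U>)
    then obtain k where k: "k \<in> \<U>" "x \<in> k" by blast
    obtain V where "openin Y V" "f x \<in> V" "\<forall>x'\<in>\<Union>\<S>. f x' \<in> V \<longrightarrow> x' \<in> k"
      using UN.IH[OF k] by meson
    then show ?case using k(1) by (intro exI[of _ V]) blast
  next
    case (Basis U)
    then show ?case by (rule initial)
  qed
  then show "\<exists>V. openin Y V \<and> f x \<in> V \<and>
      (\<forall>x'\<in>topspace (topology_generated_by \<S>). f x' \<in> V \<longrightarrow> x' \<in> U)"
    using \<open>x \<in> U\<close> by (simp only: topology_generated_by_topspace)
qed

lemma compactin_base_finite_cover:
  assumes B: "base_of_topology X \<B>" and K: "compactin X K" and U: "openin X U" and KU: "K \<subseteq> U"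
  shows "\<exists>\<F>. finite \<F> \<and> \<F> \<subseteq> \<B> \<and> K \<subseteq> \<Union>\<F> \<and> \<Union>\<F> \<subseteq> U"
proof -
  let ?\<U> = "{V \<in> \<B>. V \<subseteq> U}"
  have "\<forall>V\<in>?\<U>. openin X V" using B unfolding base_of_topology_def by blast
  moreover have "K \<subseteq> \<Union>?\<U>"
  proof
    fix x assume "x \<in> K"
    then obtain V where "V \<in> \<B>" "x \<in> V" "V \<subseteq> U"
      using B U KU unfolding base_of_topology_def by (metis subsetD)
    then show "x \<in> \<Union>?\<U>" by blast
  qed
  ultimately obtain \<F> where "finite \<F>" "\<F> \<subseteq> ?\<U>" "K \<subseteq> \<Union>\<F>"
    using K unfolding compactin_def by (metis (no_types, lifting))
  then show ?thesis by (intro exI[of _ \<F>]) auto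
qed

definition clopens :: "'x topology \<Rightarrow> 'x set set" where
  "clopens X = {b. openin X b \<and> closedin X b}"

lemma clopen_between:
  assumes X: "stone_space X" and K: "compactin X K" and U: "openin X U" and KU: "K \<subseteq> U"
  shows "\<exists>b\<in>clopens X. K \<subseteq> b \<and> b \<subseteq> U"
proof -
  obtain \<B> where B: "base_of_topology X \<B>" "\<And>V. V \<in> \<B> \<Longrightarrow> closedin X V"
    using X unfolding stone_space_def by blast
  obtain \<F> where F: "finite \<F>" "\<F> \<subseteq> \<B>" "K \<subseteq> \<Union>\<F>" "\<Union>\<F> \<subseteq> U"
    using compactin_base_finite_cover[OF B(1) K U KU] by (elim exE conjE)
  have "openin X (\<Union>\<F>)" using F(2) B(1) unfolding base_of_topology_def by (intro openin_Union) blast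
  moreover have "closedin X (\<Union>\<F>)" using F(1,2) B(2) by (intro closedin_Union) auto
  ultimately show ?thesis using F(3,4) unfolding clopens_def by blast
qed

text \<open>A clopen set is both compact and open, so it equals a finite union of base members, and
  there are only countably many finite subfamilies.\<close>

lemma countable_clopens:
  assumes X: "compact_space X" and B: "base_of_topology X \<B>" "countable \<B>"
  shows "countable (clopens X)"
proof -
  have "clopens X \<subseteq> Union ` {\<F>. finite \<F> \<and> \<F> \<subseteq> \<B>}"
  proof
    fix b assume b: "b \<in> clopens X"
    then have "compactin X b" using X by (auto simp: clopens_def intro: closedin_compact_space)
    moreover have "openin X b" using b by (simp add: clopens_def)
    ultimately obtain \<F> where "finite \<F>" "\<F> \<subseteq> \<B>" "b \<subseteq> \<Union>\<F>" "\<Union>\<F> \<subseteq> b"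
      using compactin_base_finite_cover[OF B(1), of b b] by auto
    then show "b \<in> Union ` {\<F>. finite \<F> \<and> \<F> \<subseteq> \<B>}"
      by (intro image_eqI[of _ _ \<F>]) auto
  qed
  moreover have "countable {\<F>. finite \<F> \<and> \<F> \<subseteq> \<B>}"
    using B(2) by (rule countable_Collect_finite_subset)
  ultimately show ?thesis by (meson countable_image countable_subset)
qed

section \<open>The compact-open topology seen through clopen sets\<close>

lemma continuous_self_map_monoid_simps [simp]:
  "carrier (continuous_self_map_monoid X) = continuous_self_maps X"
  "f \<otimes>\<^bsub>continuous_self_map_monoid X\<^esub> g = compose (topspace X) f g"
  "\<one>\<^bsub>continuous_self_map_monoid X\<^esub> = (\<lambda>x\<in>topspace X. x)"
  by (simp_all add: continuous_self_map_monoid_def)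

lemma continuous_self_maps_PiE:
  "f \<in> continuous_self_maps X \<Longrightarrow> f \<in> topspace X \<rightarrow>\<^sub>E topspace X"
  by (auto simp: continuous_self_maps_def continuous_map_def PiE_iff Pi_iff)

lemma monoid_continuous_self_map_monoid: "monoid (continuous_self_map_monoid X)"
proof
  fix f g
  assume f: "f \<in> carrier (continuous_self_map_monoid X)" and g: "g \<in> carrier (continuous_self_map_monoid X)"
  have "continuous_map X X (f \<circ> g)"
    using f g by (auto simp: continuous_self_maps_def intro: continuous_map_compose)
  then have "continuous_map X X (compose (topspace X) f g)"
    by (rule continuous_map_eq) (simp add: compose_def)
  then show "f \<otimes>\<^bsub>continuous_self_map_monoid X\<^esub> g \<in> carrier (continuous_self_map_monoid X)"
    by (simp add: continuous_self_maps_def compose_def)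
  fix h assume h: "h \<in> carrier (continuous_self_map_monoid X)"
  show "f \<otimes>\<^bsub>continuous_self_map_monoid X\<^esub> g \<otimes>\<^bsub>continuous_self_map_monoid X\<^esub> h =
      f \<otimes>\<^bsub>continuous_self_map_monoid X\<^esub> (g \<otimes>\<^bsub>continuous_self_map_monoid X\<^esub> h)"
    using continuous_self_maps_PiE[of h X] h compose_assoc[of h "topspace X" "topspace X" f g]
    by (simp add: PiE_iff Pi_iff)
next
  have "continuous_map X X (\<lambda>x\<in>topspace X. x)"
    by (rule continuous_map_eq[OF continuous_map_id]) simp
  then show "\<one>\<^bsub>continuous_self_map_monoid X\<^esub> \<in> carrier (continuous_self_map_monoid X)"
    by (simp add: continuous_self_maps_def)
next
  fix f assume f: "f \<in> carrier (continuous_self_map_monoid X)"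
  then have f': "f \<in> topspace X \<rightarrow>\<^sub>E topspace X" by (simp add: continuous_self_maps_PiE)
  show "\<one>\<^bsub>continuous_self_map_monoid X\<^esub> \<otimes>\<^bsub>continuous_self_map_monoid X\<^esub> f = f"
    using Id_compose[of f "topspace X" "topspace X"] f' by (simp add: PiE_iff Pi_iff)
  show "f \<otimes>\<^bsub>continuous_self_map_monoid X\<^esub> \<one>\<^bsub>continuous_self_map_monoid X\<^esub> = f"
    using compose_Id[of f "topspace X" "topspace X"] f' by (simp add: PiE_iff Pi_iff)
qed

lemma openin_compact_open_topology:
  "compactin X K \<Longrightarrow> openin X U \<Longrightarrow>
    openin (compact_open_topology X) {f \<in> continuous_self_maps X. f ` K \<subseteq> U}"
  unfolding compact_open_topology_def by (intro topology_generated_by_Basis) blast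

lemma Hausdorff_compact_open_topology:
  assumes X: "Hausdorff_space X"
  shows "Hausdorff_space (compact_open_topology X)"
  unfolding Hausdorff_space_def
proof (intro allI impI, elim conjE)
  fix f g
  assume "f \<in> topspace (compact_open_topology X)" "g \<in> topspace (compact_open_topology X)" and ne: "f \<noteq> g"
  then have fg: "f \<in> continuous_self_maps X" "g \<in> continuous_self_maps X"
    by (simp_all add: topspace_compact_open_topology)
  obtain x where x: "x \<in> topspace X" "f x \<noteq> g x"
    using ne fg[THEN continuous_self_maps_PiE] by (metis PiE_ext)
  have "f x \<in> topspace X" "g x \<in> topspace X"
    using fg[THEN continuous_self_maps_PiE] x(1) by auto
  then obtain U V where UV: "openin X U" "openin X V" "f x \<in> U" "g x \<in> V" "disjnt U V"
    using X x(2) unfolding Hausdorff_space_def by metis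
  have K: "compactin X {x}" using x(1) by simp
  show "\<exists>U V. openin (compact_open_topology X) U \<and> openin (compact_open_topology X) V \<and>
      f \<in> U \<and> g \<in> V \<and> disjnt U V"
    using openin_compact_open_topology[OF K UV(1)] openin_compact_open_topology[OF K UV(2)] fg UV(3-5)
    by (intro exI[of _ "{f \<in> continuous_self_maps X. f ` {x} \<subseteq> U}"]
        exI[of _ "{f \<in> continuous_self_maps X. f ` {x} \<subseteq> V}"]) (auto simp: disjnt_iff)
qed

lemma clopen_preimage:
  assumes "f \<in> continuous_self_maps X" "b \<in> clopens X"
  shows "{x \<in> topspace X. f x \<in> b} \<in> clopens X"
  using assms openin_continuous_map_preimage[of X X f b] closedin_continuous_map_preimage[of X X f b]
  by (simp add: continuous_self_maps_def clopens_def)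

lemma clopen_preimage_locally_constant_compact_open:
  assumes X: "compact_space X" and f: "f \<in> continuous_self_maps X" and b: "b \<in> clopens X"
  shows "\<exists>W. openin (compact_open_topology X) W \<and> f \<in> W \<and>
    (\<forall>g\<in>W. {x \<in> topspace X. g x \<in> b} = {x \<in> topspace X. f x \<in> b})"
proof -
  let ?c = "{x \<in> topspace X. f x \<in> b}"
  \<comment> \<open>Both \<open>?c\<close> and its complement are compact, so two subbasic
    conditions pin down the preimage of \<open>b\<close> exactly.\<close>
  let ?W = "{g \<in> continuous_self_maps X. g ` ?c \<subseteq> b} \<inter>
      {g \<in> continuous_self_maps X. g ` (topspace X - ?c) \<subseteq> topspace X - b}"
  have "?c \<in> clopens X" using f b by (rule clopen_preimage)
  then have "compactin X ?c" "compactin X (topspace X - ?c)"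
    using X by (auto simp: clopens_def intro!: closedin_compact_space)
  then have "openin (compact_open_topology X) ?W"
    using b by (intro openin_Int openin_compact_open_topology) (auto simp: clopens_def)
  moreover have "f \<in> ?W" using f continuous_self_maps_PiE[OF f] by auto
  moreover have "{x \<in> topspace X. g x \<in> b} = ?c" if "g \<in> ?W" for g
  proof (rule equalityI; rule subsetI)
    fix x assume x: "x \<in> {x \<in> topspace X. g x \<in> b}"
    have h: "g ` (topspace X - ?c) \<subseteq> topspace X - b" using that by (simp only: Int_iff mem_Collect_eq)
    show "x \<in> ?c"
    proof (rule ccontr)
      assume "x \<notin> ?c"
      with x have "x \<in> topspace X - ?c" by (intro DiffI) simp_all
      then have "g x \<in> topspace X - b" by (rule subsetD[OF h imageI])
      then show False using x by simp
    qed
  next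
    fix x assume x: "x \<in> ?c"
    have "g ` ?c \<subseteq> b" using that by (simp only: Int_iff mem_Collect_eq)
    then have "g x \<in> b" using x by (rule subsetD[OF _ imageI])
    then show "x \<in> {x \<in> topspace X. g x \<in> b}" using x by simp
  qed
  ultimately show ?thesis by (intro exI[of _ ?W] conjI ballI)
qed

lemma continuous_self_map_monoid_embeds:
  assumes X: "stone_space X"
  shows "top_monoid_embedding (opposite_monoid (continuous_self_map_monoid X)) (compact_open_topology X)
    (self_map_monoid (clopens X)) (pointwise_topology (clopens X))
    (\<lambda>f. \<lambda>b\<in>clopens X. {x \<in> topspace X. f x \<in> b})"
    (is "top_monoid_embedding _ _ _ _ ?\<psi>")
proof -
  have Xc: "compact_space X" and XH: "Hausdorff_space X" using X by (auto simp: stone_space_def)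
  have tc: "topspace (compact_open_topology X) = continuous_self_maps X"
    by (simp add: topspace_compact_open_topology)
  have \<psi>: "?\<psi> f \<in> clopens X \<rightarrow>\<^sub>E clopens X" if "f \<in> continuous_self_maps X" for f
    using clopen_preimage[OF that] by simp
  have cont: "continuous_map (compact_open_topology X) (pointwise_topology (clopens X)) ?\<psi>"
    unfolding pointwise_topology_def
  proof (rule continuous_map_into_discrete_power)
    fix b f assume b: "b \<in> clopens X" and "f \<in> topspace (compact_open_topology X)"
    then show "\<exists>U. openin (compact_open_topology X) U \<and> f \<in> U \<and> (\<forall>g\<in>U. ?\<psi> g b = ?\<psi> f b)"
      using clopen_preimage_locally_constant_compact_open[OF Xc _ b, of f] tc by simp
  qed (use \<psi> tc in simp)
  have "embedding_map (compact_open_topology X) (pointwise_topology (clopens X)) ?\<psi>"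
    unfolding compact_open_topology_def
  proof (rule embedding_mapI_subbase)
    fix W f
    assume "W \<in> {{f \<in> continuous_self_maps X. f ` K \<subseteq> U} | K U. compactin X K \<and> openin X U}" "f \<in> W"
    then obtain K U where KU: "compactin X K" "openin X U" "f ` K \<subseteq> U" "f \<in> continuous_self_maps X"
        "W = {f \<in> continuous_self_maps X. f ` K \<subseteq> U}"
      by blast
    have fK: "compactin X (f ` K)"
      using KU(1,4) by (intro image_compactin) (auto simp: continuous_self_maps_def)
    obtain b where b: "b \<in> clopens X" "f ` K \<subseteq> b" "b \<subseteq> U"
      using clopen_between[OF X fK KU(2,3)] by (elim bexE conjE)
    let ?V = "{h \<in> clopens X \<rightarrow>\<^sub>E clopens X. \<forall>i\<in>{b}. h i = ?\<psi> f i}"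
    have "openin (pointwise_topology (clopens X)) ?V"
      unfolding pointwise_topology_def using b(1) by (intro openin_cylinder) auto
    moreover have "?\<psi> f \<in> ?V" using \<psi>[OF KU(4)] by simp
    moreover have "g \<in> W" if "g \<in> \<Union>{{f \<in> continuous_self_maps X. f ` K \<subseteq> U} | K U. compactin X K \<and> openin X U}"
        "?\<psi> g \<in> ?V" for g
    proof -
      have g: "g \<in> continuous_self_maps X" using that(1) by blast
      have "{x \<in> topspace X. g x \<in> b} = {x \<in> topspace X. f x \<in> b}" using that(2) b(1) by simp
      moreover have "K \<subseteq> {x \<in> topspace X. f x \<in> b}"
        using b(2) compactin_subset_topspace[OF KU(1)] by auto
      ultimately have "K \<subseteq> {x \<in> topspace X. g x \<in> b}" by simp
      then show ?thesis using g b(3) KU(5) by auto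
    qed
    ultimately show "\<exists>V. openin (pointwise_topology (clopens X)) V \<and> ?\<psi> f \<in> V \<and>
      (\<forall>g\<in>\<Union>{{f \<in> continuous_self_maps X. f ` K \<subseteq> U} | K U. compactin X K \<and> openin X U}.
        ?\<psi> g \<in> V \<longrightarrow> g \<in> W)"
      by (intro exI[of _ ?V] conjI ballI impI)
  qed (use cont Hausdorff_compact_open_topology[OF XH] in \<open>simp_all add: compact_open_topology_def\<close>)
  moreover have "?\<psi> \<in> hom (opposite_monoid (continuous_self_map_monoid X)) (self_map_monoid (clopens X))"
  proof (rule homI)
    fix f g
    assume "f \<in> carrier (opposite_monoid (continuous_self_map_monoid X))"
      "g \<in> carrier (opposite_monoid (continuous_self_map_monoid X))"
    then have f: "f \<in> continuous_self_maps X" and g: "g \<in> continuous_self_maps X" by simp_all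
    \<comment> \<open>Taking preimages reverses composition, which is why the source is the opposite
      monoid.\<close>
    have "?\<psi> (compose (topspace X) g f) = compose (clopens X) (?\<psi> f) (?\<psi> g)"
      using clopen_preimage[OF g] continuous_self_maps_PiE[OF f]
      unfolding compose_def by (intro restrict_ext) (auto simp: PiE_iff Pi_iff)
    then show "?\<psi> (f \<otimes>\<^bsub>opposite_monoid (continuous_self_map_monoid X)\<^esub> g) =
        ?\<psi> f \<otimes>\<^bsub>self_map_monoid (clopens X)\<^esub> ?\<psi> g"
      by simp
  qed (use \<psi> in simp)
  moreover have "?\<psi> (\<lambda>x\<in>topspace X. x) = (\<lambda>b\<in>clopens X. b)"
  proof (rule restrict_ext)
    fix b assume "b \<in> clopens X"
    then have "b \<subseteq> topspace X" by (auto simp: clopens_def dest: openin_subset)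
    then show "{x \<in> topspace X. (\<lambda>x\<in>topspace X. x) x \<in> b} = b" by auto
  qed
  ultimately show ?thesis by (simp add: top_monoid_embedding_def)
qed

text \<open>The preimage map makes the opposite monoid a topological submonoid of a self-map monoid.
  Joint continuity and the r-NA property are inherited along it, and reversing multiplication once
  more gives l-NA.\<close>

lemma l_NA_continuous_self_map_monoid:
  assumes X: "stone_space X"
  shows "l_NA (continuous_self_map_monoid X) (compact_open_topology X)"
proof -
  let ?S = "opposite_monoid (continuous_self_map_monoid X)"
  interpret monoid "continuous_self_map_monoid X" by (rule monoid_continuous_self_map_monoid)
  have "monoid ?S"
    by unfold_locales (use m_assoc in \<open>auto simp del: continuous_self_map_monoid_simps\<close>)
  then have "topological_monoid ?S (compact_open_topology X)"
    by (rule topological_monoid_if_embeds[OF _ _ topological_monoid_self_map_monoid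
          continuous_self_map_monoid_embeds[OF X]]) (simp add: topspace_compact_open_topology)
  then have "r_NA ?S (compact_open_topology X)"
    by (rule r_NA_if_embeds_self_map_monoid[OF _ continuous_self_map_monoid_embeds[OF X]])
  then show ?thesis using l_NA_opposite by fastforce
qed

section \<open>The Cantor cube\<close>

lemma topspace_cantor_cube [simp]: "topspace cantor_cube = UNIV"
  by (simp add: cantor_cube_def)

lemma stone_space_cantor_cube: "stone_space cantor_cube"
  using stone_space_closed_subspace_discrete_power[of "UNIV :: bool set" "UNIV :: nat set" UNIV]
    closedin_topspace[of cantor_cube]
  by (simp add: cantor_cube_def)

lemma countable_clopens_cantor_cube: "countable (clopens cantor_cube)"
proof -
  obtain \<B> where "base_of_topology cantor_cube \<B>" "countable \<B>"
    using discrete_power_countable_base[of "UNIV :: bool set" "UNIV :: nat set"]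
    unfolding cantor_cube_def by auto
  moreover have "compact_space cantor_cube"
    using stone_space_cantor_cube by (simp add: stone_space_def)
  ultimately show ?thesis by (intro countable_clopens)
qed

lemma cantor_coordinate_clopen: "{x. x n} \<in> clopens cantor_cube"
  using clopen_coordinate[of n "UNIV :: nat set" "UNIV :: bool set" "\<lambda>a. a"]
  by (simp add: clopens_def cantor_cube_def)

lemma continuous_map_into_cantor_cube:
  assumes "\<And>n. {x \<in> topspace X. f x n} \<in> clopens X"
  shows "continuous_map X cantor_cube f"
  unfolding cantor_cube_def
proof (rule continuous_map_into_discrete_power)
  fix n x assume x: "x \<in> topspace X"
  let ?c = "{x \<in> topspace X. f x n}"
  have c: "openin X ?c" "openin X (topspace X - ?c)"
    using assms[of n] by (auto simp: clopens_def)
  show "\<exists>U. openin X U \<and> x \<in> U \<and> (\<forall>y\<in>U. f y n = f x n)"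
  proof (cases "f x n")
    case True
    then show ?thesis using c(1) x by (intro exI[of _ ?c]) simp
  next
    case False
    then show ?thesis using c(2) x by (intro exI[of _ "topspace X - ?c"]) simp
  qed
qed simp

text \<open>A self-map of the Cantor cube is a sequence of continuous maps to \<open>{0, 1}\<close>, that is, a
  sequence of clopen sets.\<close>

lemma homeomorphic_map_compact_open_cantor:
  "homeomorphic_map (compact_open_topology cantor_cube)
    (discrete_power (clopens cantor_cube) (UNIV :: nat set)) (\<lambda>f n. {x. f x n})"
    (is "homeomorphic_map ?co ?P ?\<theta>")
proof -
  have Xc: "compact_space cantor_cube" and XH: "Hausdorff_space cantor_cube"
    using stone_space_cantor_cube by (auto simp: stone_space_def)
  have tc: "topspace ?co = continuous_self_maps cantor_cube"
    by (simp add: topspace_compact_open_topology)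
  have \<theta>: "?\<theta> f n \<in> clopens cantor_cube" if "f \<in> continuous_self_maps cantor_cube" for f n
    using clopen_preimage[OF that cantor_coordinate_clopen[of n]] by simp
  have cont: "continuous_map ?co ?P ?\<theta>"
  proof (rule continuous_map_into_discrete_power)
    fix n :: nat and f assume "f \<in> topspace ?co"
    then have f: "f \<in> continuous_self_maps cantor_cube" using tc by simp
    show "\<exists>U. openin ?co U \<and> f \<in> U \<and> (\<forall>g\<in>U. ?\<theta> g n = ?\<theta> f n)"
      using clopen_preimage_locally_constant_compact_open[OF Xc f cantor_coordinate_clopen[of n]]
      by simp
  qed (use \<theta> tc in \<open>simp add: PiE_iff\<close>)
  have "embedding_map ?co ?P ?\<theta>"
    unfolding compact_open_topology_def
  proof (rule embedding_mapI_subbase)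
    let ?\<S> = "{{f \<in> continuous_self_maps cantor_cube. f ` K \<subseteq> U} | K U.
      compactin cantor_cube K \<and> openin cantor_cube U}"
    fix W f assume "W \<in> ?\<S>" "f \<in> W"
    then obtain K U where KU: "compactin cantor_cube K" "openin cantor_cube U" "f ` K \<subseteq> U"
        "f \<in> continuous_self_maps cantor_cube"
        "W = {f \<in> continuous_self_maps cantor_cube. f ` K \<subseteq> U}"
      by blast
    have fK: "compactin cantor_cube (f ` K)"
      using KU(1,4) by (intro image_compactin) (auto simp: continuous_self_maps_def)
    \<comment> \<open>Cylinders are taken as the base because membership in one of them depends on
      finitely many coordinates only.\<close>
    define cyl where "cyl F y = {z. \<forall>n\<in>F. z n = y n}" for F and y :: "nat \<Rightarrow> bool"
    define \<B> where "\<B> = (\<lambda>(F, y). cyl F y) ` ({F. finite F} \<times> UNIV)"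
    have base: "base_of_topology cantor_cube \<B>"
      unfolding base_of_topology_def
    proof (intro conjI ballI allI impI)
      fix V assume "V \<in> \<B>"
      then obtain F y where F: "finite F" "V = cyl F y"
        unfolding \<B>_def by auto
      show "openin cantor_cube V"
        using openin_cylinder[OF F(1), of "UNIV :: nat set" "UNIV :: bool set" y] F(2)
        by (simp add: cantor_cube_def cyl_def)
    next
      fix O' x assume O': "openin cantor_cube O' \<and> x \<in> O'"
      then obtain F where F: "finite F" "\<forall>y. (\<forall>i\<in>F. y i = x i) \<longrightarrow> y \<in> O'"
        unfolding cantor_cube_def openin_discrete_power by auto
      have "cyl F x \<in> \<B>" unfolding \<B>_def using F(1) by (intro image_eqI[of _ _ "(F, x)"]) auto
      moreover have "x \<in> cyl F x" "cyl F x \<subseteq> O'" unfolding cyl_def using F(2) by auto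
      ultimately show "\<exists>V\<in>\<B>. x \<in> V \<and> V \<subseteq> O'" by (intro bexI[of _ "cyl F x"] conjI)
    qed
    obtain \<F> where \<F>: "finite \<F>" "\<F> \<subseteq> \<B>" "f ` K \<subseteq> \<Union>\<F>" "\<Union>\<F> \<subseteq> U"
      using compactin_base_finite_cover[OF base fK KU(2,3)] by (elim exE conjE)
    have "\<exists>F. finite F \<and> (\<forall>y\<in>V. cyl F y \<subseteq> V)" if V: "V \<in> \<F>" for V
    proof -
      obtain F y where "finite F" "V = cyl F y" using subsetD[OF \<F>(2) V] unfolding \<B>_def by auto
      then show ?thesis by (intro exI[of _ F]) (auto simp: cyl_def)
    qed
    then obtain G where G: "\<And>V. V \<in> \<F> \<Longrightarrow> finite (G V)"
        "\<And>V y. V \<in> \<F> \<Longrightarrow> y \<in> V \<Longrightarrow> cyl (G V) y \<subseteq> V"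
      by metis
    define N where "N = (\<Union>V\<in>\<F>. G V)"
    have N: "finite N" unfolding N_def using \<F>(1) G by simp
    let ?V = "{h \<in> UNIV \<rightarrow>\<^sub>E clopens cantor_cube. \<forall>n\<in>N. h n = ?\<theta> f n}"
    have "openin ?P ?V" using N by (intro openin_cylinder) auto
    moreover have "?\<theta> f \<in> ?V" using \<theta>[OF KU(4)] by (simp add: PiE_iff)
    moreover have "g \<in> W" if "g \<in> \<Union>?\<S>" "?\<theta> g \<in> ?V" for g
    proof -
      have g: "g \<in> continuous_self_maps cantor_cube" using that(1) by blast
      have "\<forall>n\<in>N. ?\<theta> g n = ?\<theta> f n" using that(2) by simp
      then have eq: "g x n = f x n" if "n \<in> N" for x n
        using that by (auto simp: set_eq_iff)
      have "g x \<in> U" if "x \<in> K" for x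
      proof -
        obtain V where V: "V \<in> \<F>" "f x \<in> V" using \<F>(3) \<open>x \<in> K\<close> by (auto simp: image_subset_iff)
        have "g x n = f x n" if "n \<in> G V" for n
          using that V(1) by (intro eq) (auto simp: N_def)
        then have "g x \<in> cyl (G V) (f x)" by (simp add: cyl_def)
        then have "g x \<in> V" using G(2)[OF V] by blast
        then show ?thesis using V(1) \<F>(4) by auto
      qed
      then show ?thesis using g KU(5) by auto
    qed
    ultimately show "\<exists>V. openin ?P V \<and> ?\<theta> f \<in> V \<and> (\<forall>g\<in>\<Union>?\<S>. ?\<theta> g \<in> V \<longrightarrow> g \<in> W)"
      by (intro exI[of _ ?V] conjI ballI impI)
  qed (use cont Hausdorff_compact_open_topology[OF XH] in \<open>simp_all add: compact_open_topology_def\<close>)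
  moreover have "?\<theta> ` topspace ?co = topspace ?P"
  proof (rule equalityI)
    show "?\<theta> ` topspace ?co \<subseteq> topspace ?P" using \<theta> tc by (auto simp: PiE_iff)
    show "topspace ?P \<subseteq> ?\<theta> ` topspace ?co"
    proof
      fix g assume "g \<in> topspace ?P"
      then have g: "g n \<in> clopens cantor_cube" for n by (auto simp: PiE_iff)
      \<comment> \<open>Any sequence of clopen sets arises: its members serve as the truth sets of
        the output coordinates.\<close>
      have "continuous_map cantor_cube cantor_cube (\<lambda>x n. x \<in> g n)"
        using g by (intro continuous_map_into_cantor_cube) simp
      then have "(\<lambda>x n. x \<in> g n) \<in> topspace ?co"
        by (simp add: tc continuous_self_maps_def)
      then show "g \<in> ?\<theta> ` topspace ?co"
        by (intro image_eqI[of _ _ "\<lambda>x n. x \<in> g n"]) auto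
    qed
  qed
  ultimately show ?thesis by (simp add: surjective_embedding_map[symmetric])
qed

text \<open>Since the Cantor cube has only countably many clopen sets, the space of self-maps is a
  countable power of a countable discrete space.\<close>

lemma polish_compact_open_cantor: "polish_topology (compact_open_topology cantor_cube)"
proof -
  have "compact_open_topology cantor_cube homeomorphic_space
      discrete_power (clopens cantor_cube) (UNIV :: nat set)"
    using homeomorphic_map_compact_open_cantor by (rule homeomorphic_map_imp_homeomorphic_space)
  moreover have "polish_topology (discrete_power (clopens cantor_cube) (UNIV :: nat set))"
    by (intro polish_topology_discrete_power countable_clopens_cantor_cube) auto
  ultimately show ?thesis
    using homeomorphic_completely_metrizable_space homeomorphic_separable_space
    unfolding polish_topology_def by blast
qed

text \<open>Natural numbers index the coordinates of the cube, so \<open>h\<close> acts by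
  relabelling them. In terms of clopen sets the map sends \<open>h\<close> to the sequence of the
  sets of all \<open>z\<close> with \<open>z (h n)\<close> true: its n-th entry depends only on
  \<open>h n\<close> and determines \<open>h n\<close>. Substituting on the right reverses the order
  of composition.\<close>

lemma opposite_self_map_monoid_embeds_cantor:
  "top_monoid_embedding (opposite_monoid (self_map_monoid (UNIV :: nat set)))
    (pointwise_topology UNIV) (continuous_self_map_monoid cantor_cube)
    (compact_open_topology cantor_cube) (\<lambda>h z. z \<circ> h)"
    (is "top_monoid_embedding _ ?T _ ?co ?\<chi>")
proof -
  let ?\<theta> = "\<lambda>(f :: (nat \<Rightarrow> bool) \<Rightarrow> nat \<Rightarrow> bool) n. {x. f x n}"
  have e: "embedding_map ?co (discrete_power (clopens cantor_cube) UNIV) ?\<theta>"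
    using homeomorphic_map_compact_open_cantor by (simp add: surjective_embedding_map[symmetric])
  have \<chi>: "?\<chi> h \<in> continuous_self_maps cantor_cube" for h :: "nat \<Rightarrow> nat"
    using cantor_coordinate_clopen
    by (auto simp: continuous_self_maps_def intro!: continuous_map_into_cantor_cube)
  have "continuous_map ?T (discrete_power (clopens cantor_cube) UNIV) (\<lambda>h. ?\<theta> (?\<chi> h))"
  proof (rule continuous_map_into_discrete_power)
    fix n :: nat and h :: "nat \<Rightarrow> nat"
    have "openin ?T {k \<in> UNIV \<rightarrow>\<^sub>E UNIV. \<forall>i\<in>{n}. k i = h i}"
      unfolding pointwise_topology_def by (intro openin_cylinder) auto
    then show "\<exists>U. openin ?T U \<and> h \<in> U \<and> (\<forall>k\<in>U. ?\<theta> (?\<chi> k) n = ?\<theta> (?\<chi> h) n)"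
      by (intro exI[of _ "{k \<in> UNIV \<rightarrow>\<^sub>E UNIV. \<forall>i\<in>{n}. k i = h i}"] conjI ballI) simp_all
  qed (use cantor_coordinate_clopen in \<open>simp add: PiE_iff\<close>)
  then have "continuous_map ?T ?co ?\<chi>"
    by (rule continuous_map_into_embedding[OF e, rotated]) (use \<chi> in \<open>simp add: topspace_compact_open_topology o_def\<close>)
  then have "embedding_map ?T ?co ?\<chi>"
  proof (rule embedding_mapI)
    show "Hausdorff_space ?T"
      unfolding pointwise_topology_def by (rule Hausdorff_space_discrete_power)
    fix U and h :: "nat \<Rightarrow> nat" assume "openin ?T U" "h \<in> U"
    then obtain F where F: "finite F" "\<forall>k. (\<forall>i\<in>F. k i = h i) \<longrightarrow> k \<in> U"
      unfolding pointwise_topology_def openin_discrete_power by auto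
    let ?W = "{g \<in> UNIV \<rightarrow>\<^sub>E clopens cantor_cube. \<forall>i\<in>F. g i = ?\<theta> (?\<chi> h) i}"
    let ?V = "{f \<in> topspace ?co. ?\<theta> f \<in> ?W}"
    have "openin ?co ?V"
      using F(1) by (intro openin_continuous_map_preimage[OF embedding_mapD(1)[OF e]] openin_cylinder) auto
    moreover have "?\<chi> h \<in> ?V"
      using \<chi> cantor_coordinate_clopen by (simp add: topspace_compact_open_topology PiE_iff)
    moreover have "k \<in> U" if "?\<chi> k \<in> ?V" for k
    proof -
      have "k i = h i" if "i \<in> F" for i
      proof -
        have "{x. x (k i)} = {x :: nat \<Rightarrow> bool. x (h i)}"
          using \<open>?\<chi> k \<in> ?V\<close> that by simp
        \<comment> \<open>The indicator of the point \<open>k i\<close> is true at no other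
          coordinate, so equality of the two clopen sets forces \<open>h i = k i\<close>.\<close>
        moreover have "(\<lambda>n. n = k i) \<in> {x. x (k i)}" by simp
        ultimately have "(\<lambda>n. n = k i) \<in> {x. x (h i)}" by (simp only:)
        then show ?thesis by simp
      qed
      then show ?thesis using F(2) by simp
    qed
    ultimately show "\<exists>V. openin ?co V \<and> ?\<chi> h \<in> V \<and> (\<forall>k\<in>topspace ?T. ?\<chi> k \<in> V \<longrightarrow> k \<in> U)"
      by (intro exI[of _ ?V] conjI ballI impI)
  qed
  moreover have "?\<chi> \<in> hom (opposite_monoid (self_map_monoid UNIV)) (continuous_self_map_monoid cantor_cube)"
    by (rule homI) (auto simp: \<chi> compose_def fun_eq_iff)
  ultimately show ?thesis
    by (auto simp: top_monoid_embedding_def fun_eq_iff)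
qed

section \<open>Universality of the two separable metrizable targets and of the self-map
  monoids\<close>

lemma embeds_pointwise_topology_nat:
  assumes "r_NA S T" "separable_space T" "metrizable_space T"
  shows "embeds_as_top_monoid S T (self_map_monoid (UNIV :: nat set)) (pointwise_topology UNIV)"
proof -
  obtain \<B> where B: "base_of_topology T \<B>" "countable \<B>"
    using separable_metrizable_countable_base assms by blast
  then show ?thesis
    using r_NA_embeds_in_self_map_monoid[OF assms(1) B(1), of "UNIV :: nat set"]
    by (simp add: countable_iff_card_of_ordLeq)
qed

text \<open>The opposite of \<open>S\<close> is r-NA with the same topology \<open>T\<close>, so it
  embeds into the self-maps of the natural numbers. Reversing this embedding represents
  \<open>S\<close> in the opposite of that monoid, which embeds into C(2^\<omega>,
  2^\<omega>).\<close>

lemma embeds_compact_open_cantor: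
  assumes "l_NA S T" "separable_space T" "metrizable_space T"
  shows "embeds_as_top_monoid S T (continuous_self_map_monoid cantor_cube)
    (compact_open_topology cantor_cube)"
proof -
  obtain f where "top_monoid_embedding (opposite_monoid S) T
      (self_map_monoid (UNIV :: nat set)) (pointwise_topology UNIV) f"
    using embeds_pointwise_topology_nat[OF r_NA_opposite[OF assms(1)] assms(2,3)]
    unfolding embeds_as_top_monoid_def by blast
  from top_monoid_embedding_compose[OF top_monoid_embedding_opposite[OF this]
      opposite_self_map_monoid_embeds_cantor]
  show ?thesis unfolding embeds_as_top_monoid_def by auto
qed

text \<open>The compactification by graphs applies to the identity embedding.\<close>

lemma r_NA_self_map_monoid: "r_NA (self_map_monoid K) (pointwise_topology K)"
proof (rule r_NA_if_embeds_self_map_monoid[OF topological_monoid_self_map_monoid])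
  show "top_monoid_embedding (self_map_monoid K) (pointwise_topology K)
      (self_map_monoid K) (pointwise_topology K) id"
    by (simp add: top_monoid_embedding_def hom_def embedding_map_def homeomorphic_map_id)
qed

lemma embeds_pointwise_topology_weight:
  assumes \<kappa>: "Cinfinite \<kappa>" and NA: "r_NA S T" and w: "has_weight T \<kappa>"
  shows "embeds_as_top_monoid S T (self_map_monoid (Field \<kappa>)) (pointwise_topology (Field \<kappa>))"
proof -
  obtain \<B> where B: "base_of_topology T \<B>" "(card_of \<B>, \<kappa>) \<in> ordIso"
    using w unfolding has_weight_def by blast
  have "(card_of \<B>, card_of (Field \<kappa>)) \<in> ordIso"
    using \<kappa> by (intro ordIso_transitive[OF B(2)] ordIso_symmetric[OF card_of_Field_ordIso]) simp
  then have "(card_of \<B>, card_of (Field \<kappa>)) \<in> ordLeq" by (simp add: ordIso_iff_ordLeq)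
  moreover have "infinite (Field \<kappa>)" using \<kappa> by (simp add: cinfinite_def)
  ultimately show ?thesis by (intro r_NA_embeds_in_self_map_monoid[OF NA B(1)])
qed

theorem theorem1p2:
  shows
    "(polish_topology (pointwise_topology (UNIV :: nat set)) \<and>
      separable_space (pointwise_topology (UNIV :: nat set)) \<and>
      metrizable_space (pointwise_topology (UNIV :: nat set)) \<and>
      r_NA (self_map_monoid (UNIV :: nat set)) (pointwise_topology (UNIV :: nat set)) \<and>
      (\<forall>(S :: 'a monoid) T.
         r_NA S T \<and> separable_space T \<and> metrizable_space T \<longrightarrow>
         embeds_as_top_monoid S T
           (self_map_monoid (UNIV :: nat set)) (pointwise_topology (UNIV :: nat set))))
     \<and>
     (\<forall>\<kappa> :: 'k rel. Cinfinite \<kappa> \<longrightarrow>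
        r_NA (self_map_monoid (Field \<kappa>)) (pointwise_topology (Field \<kappa>)) \<and>
        has_weight (pointwise_topology (Field \<kappa>)) \<kappa> \<and>
        (\<forall>(S :: 'b monoid) T.
           r_NA S T \<and> has_weight T \<kappa> \<longrightarrow>
           embeds_as_top_monoid S T
             (self_map_monoid (Field \<kappa>)) (pointwise_topology (Field \<kappa>))))
     \<and>
     (polish_topology (compact_open_topology cantor_cube) \<and>
      separable_space (compact_open_topology cantor_cube) \<and>
      metrizable_space (compact_open_topology cantor_cube) \<and>
      l_NA (continuous_self_map_monoid cantor_cube) (compact_open_topology cantor_cube) \<and>
      (\<forall>(S :: 'c monoid) T.
         l_NA S T \<and> separable_space T \<and> metrizable_space T \<longrightarrow>
         embeds_as_top_monoid S T
           (continuous_self_map_monoid cantor_cube) (compact_open_topology cantor_cube)))"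
proof -
  have "polish_topology (pointwise_topology (UNIV :: nat set))"
    unfolding pointwise_topology_def by (rule polish_topology_discrete_power) auto
  then show ?thesis
    using polish_compact_open_cantor
    by (intro conjI allI impI)
      (simp_all add: polish_topology_def completely_metrizable_imp_metrizable_space
        r_NA_self_map_monoid l_NA_continuous_self_map_monoid stone_space_cantor_cube
        has_weight_pointwise_topology embeds_pointwise_topology_nat
        embeds_pointwise_topology_weight embeds_compact_open_cantor)
qed

end
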